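(* Let $\mathcal{M} \models \mathsf{PA}$ and $I \subseteq_e M$. The following are equivalent: (1) $I$ is $\omega$-coded and separable; (2) $I$ is $0$-superrational.
   Context: $I\subseteq_e M$ is a cut of $M$; $(a)_i$ denotes the $i$-th element of the sequence coded by $a$. $I$ is separable if for each $a\in M$ there is $c\in M$ such that for each $n\in\omega$, $(a)_n\in I$ iff $\mathcal{M}\models n\in c$. $I$ is coded by $\omega$ from below if there is $a\in M$ with $I = \sup(\{(a)_i : i\in\omega\})$, and coded by $\omega$ from above if there is $a\in M$ with $I=\inf(\{(a)_i: i\in\omega\})$; $I$ is $\omega$-coded if it is coded by $\omega$ from below or from above. $\mathrm{Def}_0(a)$ is the set of elements of $\mathcal{M}$ that are $\Delta_0$-definable from $a$ in $\mathcal{M}$. $I$ is $0$-superrational if there is $a \in M$ such that either $\mathrm{Def}_0(a)\cap I$ is cofinal in $I$ and for all $b\in M$, $\mathrm{Def}_0(b)\setminus I$ is not coinitial in $M\setminus I$; or $\mathrm{Def}_0(a)\setminus I$ is coinitial in $M\setminus I$ and for all $b\in M$, $\mathrm{Def}_0(b)\cap I$ is not cofinal in $I$. *)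

theory Defs
  imports Main
begin

datatype tm = Var nat | Zero | One | Add tm tm | Mul tm tm

datatype fm = Eq tm tm | Less tm tm | Neg fm | Conj fm fm | Exists nat fm

primrec tm_vars :: "tm \<Rightarrow> nat set" where
  "tm_vars (Var x) = {x}"
| "tm_vars Zero = {}"
| "tm_vars One = {}"
| "tm_vars (Add s t) = tm_vars s \<union> tm_vars t"
| "tm_vars (Mul s t) = tm_vars s \<union> tm_vars t"

primrec free_vars :: "fm \<Rightarrow> nat set" where
  "free_vars (Eq s t) = tm_vars s \<union> tm_vars t"
| "free_vars (Less s t) = tm_vars s \<union> tm_vars t"
| "free_vars (Neg \<phi>) = free_vars \<phi>"
| "free_vars (Conj \<phi> \<psi>) = free_vars \<phi> \<union> free_vars \<psi>"
| "free_vars (Exists x \<phi>) = free_vars \<phi> - {x}"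

class arith_struct = zero + one + plus + times + ord
begin

primrec tm_val :: "(nat \<Rightarrow> 'a) \<Rightarrow> tm \<Rightarrow> 'a" where
  "tm_val e (Var x) = e x"
| "tm_val e Zero = 0"
| "tm_val e One = 1"
| "tm_val e (Add s t) = tm_val e s + tm_val e t"
| "tm_val e (Mul s t) = tm_val e s * tm_val e t"

primrec sat :: "(nat \<Rightarrow> 'a) \<Rightarrow> fm \<Rightarrow> bool" where
  "sat e (Eq s t) \<longleftrightarrow> tm_val e s = tm_val e t"
| "sat e (Less s t) \<longleftrightarrow> tm_val e s < tm_val e t"
| "sat e (Neg \<phi>) \<longleftrightarrow> \<not> sat e \<phi>"
| "sat e (Conj \<phi> \<psi>) \<longleftrightarrow> sat e \<phi> \<and> sat e \<psi>"
| "sat e (Exists x \<phi>) \<longleftrightarrow> (\<exists>a. sat (e(x := a)) \<phi>)"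

end

text \<open>Bounded universal quantifiers and the remaining connectives arise by negation.\<close>

inductive Delta0 :: "fm \<Rightarrow> bool" where
  "Delta0 (Eq s t)"
| "Delta0 (Less s t)"
| "Delta0 \<phi> \<Longrightarrow> Delta0 (Neg \<phi>)"
| "Delta0 \<phi> \<Longrightarrow> Delta0 \<psi> \<Longrightarrow> Delta0 (Conj \<phi> \<psi>)"
| "Delta0 \<phi> \<Longrightarrow> x \<notin> tm_vars t \<Longrightarrow> Delta0 (Exists x (Conj (Less (Var x) t) \<phi>))"

text \<open>
  A model of PA is a type of the following class: the axioms of discretely ordered
  semirings with least element \<open>0\<close> (Kaye's system PA\<open>\<^sup>-\<close>; commutative semiring and
  linear order laws are inherited), and the induction scheme for all first-order
  formulas of the language \<open>0, 1, +, *, <\<close>.  The assignment \<open>e\<close> supplies the parameters.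
\<close>

class peano_model = comm_semiring_1 + linorder + arith_struct +
  assumes PA_add_strict_mono: "x < y \<Longrightarrow> x + z < y + z"
    and PA_mult_strict_mono: "0 < z \<Longrightarrow> x < y \<Longrightarrow> x * z < y * z"
    and PA_less_imp_add: "x < y \<Longrightarrow> \<exists>z. x + z = y"
    and PA_zero_less_one: "0 < 1"
    and PA_discrete: "0 < x \<Longrightarrow> 1 \<le> x"
    and PA_zero_least: "0 \<le> x"
    and PA_induct: "sat (e(v := 0)) \<phi> \<Longrightarrow>
      (\<And>x. sat (e(v := x)) \<phi> \<Longrightarrow> sat (e(v := x + 1)) \<phi>) \<Longrightarrow> sat (e(v := y)) \<phi>"

text \<open>The standard model; \<open>\<omega>\<close> is identified with \<open>range of_nat\<close> in every model.\<close>

instance nat :: arith_struct ..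

instance nat :: peano_model
proof
  fix e :: "nat \<Rightarrow> nat" and v y :: nat and \<phi> :: fm
  assume "sat (e(v := 0)) \<phi>"
    and "\<And>x. sat (e(v := x)) \<phi> \<Longrightarrow> sat (e(v := x + 1)) \<phi>"
  then show "sat (e(v := y)) \<phi>"
    by (induction y) simp_all
next
  fix x y :: nat
  assume "x < y"
  then show "\<exists>z. x + z = y"
    by (intro exI[of _ "y - x"]) simp
qed simp_all

text \<open>
  \<open>seq_nth a i\<close> is \<open>(a)\<^sub>i\<close>, by Goedel's beta function: if \<open>a\<close> is the Cantor pair
  \<open>\<langle>u, v\<rangle> = (u + v) (u + v + 1) / 2 + v\<close>, then \<open>(a)\<^sub>i\<close> is the remainder of \<open>u\<close> modulo
  \<open>1 + (i + 1) v\<close>.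
\<close>

definition seq_nth :: "'a::peano_model \<Rightarrow> 'a \<Rightarrow> 'a" where
  "seq_nth a i = (THE r. \<exists>u v q. 2 * a = (u + v) * (u + v + 1) + 2 * v \<and>
     u = q * (1 + (i + 1) * v) + r \<and> r < 1 + (i + 1) * v)"

text \<open>Ackermann membership: the \<open>x\<close>-th binary digit of \<open>c\<close> is \<open>1\<close>, where the graph of
  \<open>x \<mapsto> 2\<^sup>x\<close> is defined inside the model.\<close>

definition pow2 :: "'a::peano_model \<Rightarrow> 'a \<Rightarrow> bool" where
  "pow2 x p \<longleftrightarrow> (\<exists>s. seq_nth s 0 = 1 \<and> (\<forall>i<x. seq_nth s (i + 1) = 2 * seq_nth s i) \<and>
     seq_nth s x = p)"

definition mem :: "'a::peano_model \<Rightarrow> 'a \<Rightarrow> bool" where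
  "mem x c \<longleftrightarrow> (\<exists>p q r. pow2 x p \<and> r < p \<and> c = (2 * q + 1) * p + r)"

definition is_cut :: "'a::peano_model set \<Rightarrow> bool" where
  "is_cut I \<longleftrightarrow> I \<noteq> {} \<and> I \<noteq> UNIV \<and> (\<forall>x\<in>I. \<forall>y\<le>x. y \<in> I) \<and> (\<forall>x\<in>I. x + 1 \<in> I)"

definition sup_seg :: "'a::peano_model set \<Rightarrow> 'a set" where
  "sup_seg A = {x. \<exists>y\<in>A. x \<le> y}"

definition inf_seg :: "'a::peano_model set \<Rightarrow> 'a set" where
  "inf_seg A = {x. \<forall>y\<in>A. x < y}"

definition cofinal_in :: "'a::peano_model set \<Rightarrow> 'a set \<Rightarrow> bool" where
  "cofinal_in A B \<longleftrightarrow> A \<subseteq> B \<and> (\<forall>x\<in>B. \<exists>y\<in>A. x \<le> y)"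

definition coinitial_in :: "'a::peano_model set \<Rightarrow> 'a set \<Rightarrow> bool" where
  "coinitial_in A B \<longleftrightarrow> A \<subseteq> B \<and> (\<forall>x\<in>B. \<exists>y\<in>A. y \<le> x)"

definition separable :: "'a::peano_model set \<Rightarrow> bool" where
  "separable I \<longleftrightarrow>
     (\<forall>a. \<exists>c::'a. \<forall>n::nat. seq_nth a (of_nat n) \<in> I \<longleftrightarrow> mem (of_nat n) c)"

definition coded_from_below :: "'a::peano_model set \<Rightarrow> bool" where
  "coded_from_below I \<longleftrightarrow> (\<exists>a. I = sup_seg (range (\<lambda>n::nat. seq_nth a (of_nat n))))"

definition coded_from_above :: "'a::peano_model set \<Rightarrow> bool" where
  "coded_from_above I \<longleftrightarrow> (\<exists>a. I = inf_seg (range (\<lambda>n::nat. seq_nth a (of_nat n))))"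

definition omega_coded :: "'a::peano_model set \<Rightarrow> bool" where
  "omega_coded I \<longleftrightarrow> coded_from_below I \<or> coded_from_above I"

text \<open>\<open>b\<close> is the unique element satisfying \<open>\<phi>(b, a)\<close>, with variable \<open>0\<close> for the
  defined element and variable \<open>1\<close> for the parameter.\<close>

definition Def0 :: "'a::peano_model \<Rightarrow> 'a set" where
  "Def0 a = {b. \<exists>\<phi>. Delta0 \<phi> \<and> free_vars \<phi> \<subseteq> {0, 1} \<and>
     (\<forall>x. sat ((\<lambda>_. 0)(0 := x, 1 := a)) \<phi> \<longleftrightarrow> x = b)}"

definition superrational0 :: "'a::peano_model set \<Rightarrow> bool" where
  "superrational0 I \<longleftrightarrow> (\<exists>a.
     (cofinal_in (Def0 a \<inter> I) I \<and> (\<forall>b. \<not> coinitial_in (Def0 b - I) (- I))) \<or>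
     (coinitial_in (Def0 a - I) (- I) \<and> (\<forall>b. \<not> cofinal_in (Def0 b \<inter> I) I)))"

end

theory Submission imports Defs begin

text \<open>
  A cut of \<open>M\<close> is proper, so \<open>M\<close> is nonstandard.  Two facts drive the proof: each \<open>(a)\<^sub>n\<close> with
  \<open>n \<in> \<omega>\<close> lies in \<open>Def\<^sub>0(a)\<close>, and conversely, for all \<open>a\<close> and \<open>d\<close>, a single code \<open>g\<close> lists
  \<open>Def\<^sub>0(a) \<inter> [0, d]\<close> among its standard entries \<open>(g)\<^sub>n\<close>.  The latter needs a truth definition for
  \<open>\<Delta>\<^sub>0\<close> formulas: evaluating a standard \<open>\<Delta>\<^sub>0\<close> formula on arguments below \<open>m\<close> only involves numbers
  below some standard power of \<open>m\<close>, and a nonstandard power \<open>E\<close> of \<open>m\<close> bounds all of them, so the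
  Tarski clauses restricted to \<open>[0, E]\<close> can be solved by a coded sequence.

  If \<open>I\<close> is superrational, say \<open>Def\<^sub>0(a) \<inter> I\<close> is cofinal in \<open>I\<close>, then the entries of any sequence
  \<open>u\<close> outside \<open>I\<close> are not coinitial in \<open>M - I\<close>, so some \<open>x\<close> satisfies \<open>(u)\<^sub>n \<in> I \<longleftrightarrow> (u)\<^sub>n < x\<close>;
  this gives separability, and separating the entries of \<open>g\<close> gives a code of \<open>I\<close>.  If \<open>I\<close> is
  separable and \<open>\<omega>\<close>-coded from below by \<open>a\<close>, and \<open>Def\<^sub>0(b) - I\<close> were coinitial in \<open>M - I\<close>, then
  with \<open>c\<close> separating the entries of \<open>g\<close> for \<open>b\<close>, overspill applied to
  \<open>\<forall>i j. i \<le> k \<longrightarrow> j \<le> k \<longrightarrow> j \<notin> c \<longrightarrow> (a)\<^sub>i < (g)\<^sub>j\<close> yields an element strictly between \<open>I\<close> and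
  \<open>Def\<^sub>0(b) - I\<close>.  The other case is dual.
\<close>

section \<open>Definability with parameters\<close>

lemma finite_tm_vars: "finite (tm_vars t)"
  by (induction t) auto

lemma finite_free_vars: "finite (free_vars \<phi>)"
  by (induction \<phi>) (auto simp: finite_tm_vars)

lemma tm_val_cong:
  "(\<And>x. x \<in> tm_vars t \<Longrightarrow> e x = e' x) \<Longrightarrow> tm_val e t = tm_val e' t"
  by (induction t) auto

lemma sat_cong:
  "(\<And>x. x \<in> free_vars \<phi> \<Longrightarrow> e x = e' x) \<Longrightarrow> sat e \<phi> = sat e' \<phi>"
proof (induction \<phi> arbitrary: e e')
  case (Eq s t)
  then show ?case using tm_val_cong[of s e e'] tm_val_cong[of t e e'] by simp
next
  case (Less s t)
  then show ?case using tm_val_cong[of s e e'] tm_val_cong[of t e e'] by simp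
next
  case (Neg \<phi>)
  show ?case using Neg.IH[of e e'] Neg.prems by simp
next
  case (Conj \<phi> \<psi>)
  show ?case using Conj.IH[of e e'] Conj.prems by simp
next
  case (Exists x \<phi>)
  have "sat (e(x := a)) \<phi> = sat (e'(x := a)) \<phi>" for a
    using Exists.prems by (intro Exists.IH) auto
  then show ?case by simp
qed

lemma tm_rename: "\<exists>t'. \<forall>e::nat\<Rightarrow>'a::arith_struct. tm_val e t' = tm_val (\<lambda>n. e (\<rho> n)) t"
proof (induction t)
  case (Var x)
  show ?case by (rule exI[of _ "Var (\<rho> x)"]) simp
next
  case Zero
  show ?case by (rule exI[of _ Zero]) simp
next
  case One
  show ?case by (rule exI[of _ One]) simp
next
  case (Add s t)
  then obtain s' t' where "\<forall>e::nat\<Rightarrow>'a. tm_val e s' = tm_val (\<lambda>n. e (\<rho> n)) s"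
    "\<forall>e::nat\<Rightarrow>'a. tm_val e t' = tm_val (\<lambda>n. e (\<rho> n)) t" by blast
  then show ?case by (intro exI[of _ "Add s' t'"]) simp
next
  case (Mul s t)
  then obtain s' t' where "\<forall>e::nat\<Rightarrow>'a. tm_val e s' = tm_val (\<lambda>n. e (\<rho> n)) s"
    "\<forall>e::nat\<Rightarrow>'a. tm_val e t' = tm_val (\<lambda>n. e (\<rho> n)) t" by blast
  then show ?case by (intro exI[of _ "Mul s' t'"]) simp
qed

text \<open>\<open>\<rho>\<close> need not be injective, so the quantifier case moves the bound
  variable to a \<open>y\<close> outside the image of the free variables; otherwise a renamed free
  variable could be captured.\<close>

lemma fm_rename: "\<exists>\<psi>. \<forall>e::nat\<Rightarrow>'a::arith_struct. sat e \<psi> = sat (\<lambda>n. e (\<rho> n)) \<phi>"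
proof (induction \<phi> arbitrary: \<rho>)
  case (Eq s t)
  obtain s' t' where "\<forall>e::nat\<Rightarrow>'a. tm_val e s' = tm_val (\<lambda>n. e (\<rho> n)) s"
    "\<forall>e::nat\<Rightarrow>'a. tm_val e t' = tm_val (\<lambda>n. e (\<rho> n)) t" using tm_rename by blast
  then show ?case by (intro exI[of _ "Eq s' t'"]) simp
next
  case (Less s t)
  obtain s' t' where "\<forall>e::nat\<Rightarrow>'a. tm_val e s' = tm_val (\<lambda>n. e (\<rho> n)) s"
    "\<forall>e::nat\<Rightarrow>'a. tm_val e t' = tm_val (\<lambda>n. e (\<rho> n)) t" using tm_rename by blast
  then show ?case by (intro exI[of _ "Less s' t'"]) simp
next
  case (Neg \<phi>)
  obtain \<psi> where "\<forall>e::nat\<Rightarrow>'a. sat e \<psi> = sat (\<lambda>n. e (\<rho> n)) \<phi>" using Neg by blast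
  then show ?case by (intro exI[of _ "Neg \<psi>"]) simp
next
  case (Conj \<phi>1 \<phi>2)
  obtain \<psi>1 \<psi>2 where "\<forall>e::nat\<Rightarrow>'a. sat e \<psi>1 = sat (\<lambda>n. e (\<rho> n)) \<phi>1"
    "\<forall>e::nat\<Rightarrow>'a. sat e \<psi>2 = sat (\<lambda>n. e (\<rho> n)) \<phi>2" using Conj.IH(1)[of \<rho>] Conj.IH(2)[of \<rho>] by blast
  then show ?case by (intro exI[of _ "Conj \<psi>1 \<psi>2"]) simp
next
  case (Exists x \<phi>)
  obtain y where y: "y \<notin> \<rho> ` free_vars \<phi>"
    using ex_new_if_finite[OF infinite_UNIV_nat finite_imageI[OF finite_free_vars]] by blast
  obtain \<psi> where \<psi>: "\<forall>e::nat\<Rightarrow>'a. sat e \<psi> = sat (\<lambda>n. e ((\<rho>(x := y)) n)) \<phi>"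
    using Exists.IH[of "\<rho>(x := y)"] by blast
  have "sat (e(y := a)) \<psi> = sat ((\<lambda>n. e (\<rho> n))(x := a)) \<phi>" for e :: "nat \<Rightarrow> 'a" and a
    unfolding \<psi>[rule_format] using y by (intro sat_cong) auto
  then show ?case by (intro exI[of _ "Exists y \<psi>"]) simp
qed

definition env_join :: "(nat \<Rightarrow> 'a) \<Rightarrow> (nat \<Rightarrow> 'a) \<Rightarrow> nat \<Rightarrow> 'a" where
  "env_join p e n = (if even n then e (n div 2) else p (n div 2))"

text \<open>Definability with parameters in \<open>M\<close>: the parameters \<open>p\<close> occupy the odd variables.
  Predicates are functions of an environment, and quantifiers push onto it, so that goals
  of this form are decided by introduction rules alone.\<close>

definition dfn :: "((nat \<Rightarrow> 'a::peano_model) \<Rightarrow> bool) \<Rightarrow> bool" where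
  "dfn P \<longleftrightarrow> (\<exists>\<phi> p. \<forall>e. P e = sat (env_join p e) \<phi>)"

text \<open>Functions are definable through their graphs, not through terms, so that
  \<open>seq_nth\<close>, \<open>p2\<close> and conditionals can be nested like the arithmetic
  operations.\<close>

definition tdf :: "((nat \<Rightarrow> 'a::peano_model) \<Rightarrow> 'a) \<Rightarrow> bool" where
  "tdf f \<longleftrightarrow> dfn (\<lambda>e. e 0 = f (\<lambda>n. e (Suc n)))"

named_theorems dfn_intros

lemma dfnI_rename:
  assumes "\<And>e. P e = sat (\<lambda>n. env_join p e (\<rho> n)) \<phi>"
  shows "dfn P"
proof -
  obtain \<psi> where "\<And>e::nat\<Rightarrow>'a. sat e \<psi> = sat (\<lambda>n. e (\<rho> n)) \<phi>"
    using fm_rename[of \<rho> \<phi>] by blast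
  then show ?thesis using assms unfolding dfn_def by (intro exI[of _ \<psi>] exI[of _ p]) simp
qed

lemma dfn_subst:
  assumes "dfn P"
  shows "dfn (\<lambda>e. P (\<lambda>n. e (\<rho> n)))"
proof -
  obtain \<phi> p where 1: "\<And>e. P e = sat (env_join p e) \<phi>" using assms unfolding dfn_def by blast
  \<comment> \<open>Even positions hold the environment and move with \<open>\<rho>\<close>; odd
    positions hold parameters and stay.\<close>
  have 2: "env_join p (\<lambda>n. e (\<rho> n)) = (\<lambda>m. env_join p e (if even m then 2 * \<rho> (m div 2) else m))" for e
    by (auto simp: env_join_def)
  show ?thesis by (rule dfnI_rename) (simp add: 1 2)
qed

lemma dfn_not [dfn_intros]: "dfn P \<Longrightarrow> dfn (\<lambda>e. \<not> P e)"
proof -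
  assume "dfn P"
  then obtain \<phi> p where "\<And>e. P e = sat (env_join p e) \<phi>" unfolding dfn_def by blast
  then show ?thesis unfolding dfn_def by (intro exI[of _ "Neg \<phi>"] exI[of _ p]) simp
qed

lemma dfn_conj [dfn_intros]:
  assumes "dfn P" "dfn Q"
  shows "dfn (\<lambda>e. P e \<and> Q e)"
proof -
  obtain \<phi> p where 1: "\<And>e. P e = sat (env_join p e) \<phi>" using assms unfolding dfn_def by blast
  obtain \<psi> q where 2: "\<And>e. Q e = sat (env_join q e) \<psi>" using assms unfolding dfn_def by blast
  \<comment> \<open>The two parameter lists are interleaved, \<open>q\<close> at even and
    \<open>p\<close> at odd places of \<open>?r\<close>. Parameter variable \<open>2 * k + 1\<close>
    thus becomes \<open>4 * k + 3\<close> in \<open>\<phi>\<close> and \<open>4 * k + 1\<close> in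
    \<open>\<psi>\<close>.\<close>
  let ?r = "env_join p q"
  obtain \<phi>' where 3: "\<And>e::nat\<Rightarrow>'a. sat e \<phi>' = sat (\<lambda>n. e (if even n then n else 4 * (n div 2) + 3)) \<phi>"
    using fm_rename[of "\<lambda>n. if even n then n else 4 * (n div 2) + 3" \<phi>] by blast
  obtain \<psi>' where 4: "\<And>e::nat\<Rightarrow>'a. sat e \<psi>' = sat (\<lambda>n. e (if even n then n else 4 * (n div 2) + 1)) \<psi>"
    using fm_rename[of "\<lambda>n. if even n then n else 4 * (n div 2) + 1" \<psi>] by blast
  have d: "(4 * k + 3) div 2 = 2 * k + 1" "(4 * k + 1) div 2 = 2 * k" for k :: nat by auto
  have 5: "env_join p e = (\<lambda>n. env_join ?r e (if even n then n else 4 * (n div 2) + 3))" for e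
  proof
    show "env_join p e n = env_join ?r e (if even n then n else 4 * (n div 2) + 3)" for n
      by (cases "even n") (auto elim!: oddE simp: env_join_def d)
  qed
  have 6: "env_join q e = (\<lambda>n. env_join ?r e (if even n then n else 4 * (n div 2) + 1))" for e
  proof
    show "env_join q e n = env_join ?r e (if even n then n else 4 * (n div 2) + 1)" for n
      by (cases "even n") (auto elim!: oddE simp: env_join_def)
  qed
  have "(P e \<and> Q e) = sat (env_join ?r e) (Conj \<phi>' \<psi>')" for e
    unfolding 1 2 sat.simps 3 4 5[symmetric] 6[symmetric] by simp
  then show ?thesis unfolding dfn_def by blast
qed

lemma dfn_ex [dfn_intros]:
  assumes "dfn (\<lambda>e. Q (e 0) (\<lambda>n. e (Suc n)))"
  shows "dfn (\<lambda>e. \<exists>x. Q x e)"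
proof -
  obtain \<phi> p where 1: "\<And>e. Q (e 0) (\<lambda>n. e (Suc n)) = sat (env_join p e) \<phi>"
    using assms unfolding dfn_def by blast
  \<comment> \<open>The pushed value, variable \<open>0\<close>, becomes the bound variable
    \<open>1\<close>. The other even variables drop by two and the parameters rise by two, so the
    first entry of \<open>?r\<close> is a dummy.\<close>
  let ?\<rho> = "\<lambda>n. if n = 0 then 1 else if even n then n - 2 else n + 2"
  let ?r = "\<lambda>n. p (n - 1)"
  obtain \<psi> where 2: "\<And>e::nat\<Rightarrow>'a. sat e \<psi> = sat (\<lambda>n. e (?\<rho> n)) \<phi>"
    using fm_rename[of ?\<rho> \<phi>] by blast
  have 3: "(\<lambda>n. ((env_join ?r e)(1 := x)) (?\<rho> n)) = env_join p (case_nat x e)" for e x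
  proof
    fix n
    consider "n = 0" | k where "n = 2 * Suc k" | k where "n = 2 * k + 1"
      by (metis evenE oddE nat.exhaust mult_0_right)
    then show "((env_join ?r e)(1 := x)) (?\<rho> n) = env_join p (case_nat x e) n"
      by cases (auto simp: env_join_def split: nat.split)
  qed
  have "(\<exists>x. Q x e) = sat (env_join ?r e) (Exists 1 \<psi>)" for e
    using 1[of "case_nat _ e"] unfolding sat.simps 2 3 by simp
  then show ?thesis unfolding dfn_def by blast
qed

lemma dfn_disj [dfn_intros]:
  assumes "dfn P" "dfn Q"
  shows "dfn (\<lambda>e. P e \<or> Q e)"
proof -
  have "dfn (\<lambda>e. \<not> (\<not> P e \<and> \<not> Q e))" by (intro dfn_not dfn_conj assms)
  then show ?thesis by simp
qed

lemma dfn_imp [dfn_intros]: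
  assumes "dfn P" "dfn Q"
  shows "dfn (\<lambda>e. P e \<longrightarrow> Q e)"
  unfolding imp_conv_disj by (intro dfn_not dfn_disj assms)

lemma dfn_all [dfn_intros]:
  assumes "dfn (\<lambda>e. Q (e 0) (\<lambda>n. e (Suc n)))"
  shows "dfn (\<lambda>e. \<forall>x. Q x e)"
proof -
  have "dfn (\<lambda>e. \<not> (\<exists>x. \<not> Q x e))" by (intro dfn_not dfn_ex assms)
  then show ?thesis by simp
qed

lemma dfn_iff [dfn_intros]: "dfn P \<Longrightarrow> dfn Q \<Longrightarrow> dfn (\<lambda>e. P e = Q e)"
proof -
  assume "dfn P" "dfn Q"
  then have "dfn (\<lambda>e. (P e \<longrightarrow> Q e) \<and> (Q e \<longrightarrow> P e))" by (intro dfn_intros)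
  moreover have "(\<lambda>e. (P e \<longrightarrow> Q e) \<and> (Q e \<longrightarrow> P e)) = (\<lambda>e. P e = Q e)" by auto
  ultimately show ?thesis by simp
qed

lemma dfn_atomic:
  "dfn (\<lambda>e. e i = e j)" "dfn (\<lambda>e. e i < e j)" "dfn (\<lambda>e. e i = a)"
  "dfn (\<lambda>e. e i = e j + e k)" "dfn (\<lambda>e. e i = e j * e k)"
proof -
  show "dfn (\<lambda>e. e i = e j)" unfolding dfn_def
    by (rule exI[of _ "Eq (Var (2*i)) (Var (2*j))"]) (simp add: env_join_def)
  show "dfn (\<lambda>e. e i < e j)" unfolding dfn_def
    by (rule exI[of _ "Less (Var (2*i)) (Var (2*j))"]) (simp add: env_join_def)
  show "dfn (\<lambda>e. e i = a)" unfolding dfn_def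
    by (rule exI[of _ "Eq (Var (2*i)) (Var 1)"], rule exI[of _ "\<lambda>_. a"]) (simp add: env_join_def)
  show "dfn (\<lambda>e. e i = e j + e k)" unfolding dfn_def
    by (rule exI[of _ "Eq (Var (2*i)) (Add (Var (2*j)) (Var (2*k)))"]) (simp add: env_join_def)
  show "dfn (\<lambda>e. e i = e j * e k)" unfolding dfn_def
    by (rule exI[of _ "Eq (Var (2*i)) (Mul (Var (2*j)) (Var (2*k)))"]) (simp add: env_join_def)
qed

lemma tdf_var [dfn_intros]: "tdf (\<lambda>e. e n)"
  unfolding tdf_def by (rule dfn_atomic)

lemma tdf_const [dfn_intros]: "tdf (\<lambda>e. a)"
  unfolding tdf_def by (rule dfn_atomic)

lemma tdfD: "tdf f \<Longrightarrow> dfn (\<lambda>e. e i = f (\<lambda>n. e (\<rho> n)))"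
  unfolding tdf_def by (drule dfn_subst[of _ "case_nat i \<rho>"]) simp

text \<open>Substitution of definable functions into a definable relation: the values are not terms
  of the language, so existential quantifiers name them.\<close>

lemma dfn_rel3:
  assumes "dfn (\<lambda>e. R (e 0) (e 1) (e 2))" "tdf f" "tdf g" "tdf h"
  shows "dfn (\<lambda>e. R (f e) (g e) (h e))"
proof -
  \<comment> \<open>After the three pushes below, \<open>x\<close> has index \<open>2\<close> and
    \<open>z\<close> index \<open>0\<close>, hence the reversed order.\<close>
  have R: "dfn (\<lambda>e. R (e (Suc (Suc 0))) (e (Suc 0)) (e 0))"
    using dfn_subst[OF assms(1), of "\<lambda>n. 2 - n"] by (simp add: numeral_2_eq_2)
  have "dfn (\<lambda>e. \<exists>x. x = f e \<and> (\<exists>y. y = g e \<and> (\<exists>z. z = h e \<and> R x y z)))"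
    by (intro dfn_conj dfn_ex tdfD[OF assms(2)] tdfD[OF assms(3)] tdfD[OF assms(4)] R)
  then show ?thesis by simp
qed

lemma dfn_rel2:
  assumes "dfn (\<lambda>e. R (e 0) (e 1))" "tdf f" "tdf g"
  shows "dfn (\<lambda>e. R (f e) (g e))"
  using dfn_rel3[of "\<lambda>x y z. R x y" f g f] assms by simp

lemma dfn_rel1:
  assumes "dfn (\<lambda>e. R (e 0))" "tdf f"
  shows "dfn (\<lambda>e. R (f e))"
  using dfn_rel3[of "\<lambda>x y z. R x" f f f] assms by simp

lemma tdf_shift: "tdf f \<Longrightarrow> tdf (\<lambda>e. f (\<lambda>n. e (\<rho> n)))"
  using tdfD[of f 0 "\<lambda>n. Suc (\<rho> n)"] unfolding tdf_def by simp

lemma tdf_fun2: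
  assumes "dfn (\<lambda>e. e 0 = F (e 1) (e 2))" "tdf f" "tdf g"
  shows "tdf (\<lambda>e. F (f e) (g e))"
  unfolding tdf_def
  using dfn_rel3[OF assms(1) tdf_var tdf_shift[OF assms(2)] tdf_shift[OF assms(3)]] .

lemma tdf_fun1:
  assumes "dfn (\<lambda>e. e 0 = F (e 1))" "tdf f"
  shows "tdf (\<lambda>e. F (f e))"
  using tdf_fun2[of "\<lambda>x y. F x" f f] assms by simp

lemma dfn_eq [dfn_intros]: "tdf f \<Longrightarrow> tdf g \<Longrightarrow> dfn (\<lambda>e. f e = g e)"
  by (rule dfn_rel2[of "(=)"]) (rule dfn_atomic)

lemma dfn_less [dfn_intros]: "tdf f \<Longrightarrow> tdf g \<Longrightarrow> dfn (\<lambda>e. f e < g e)"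
  by (rule dfn_rel2[of "(<)"]) (rule dfn_atomic)

lemma dfn_le [dfn_intros]: "tdf f \<Longrightarrow> tdf g \<Longrightarrow> dfn (\<lambda>e. f e \<le> g e)"
  unfolding le_less by (intro dfn_intros)

lemma tdf_add [dfn_intros]: "tdf f \<Longrightarrow> tdf g \<Longrightarrow> tdf (\<lambda>e. f e + g e)"
  by (rule tdf_fun2) (rule dfn_atomic)

lemma tdf_mult [dfn_intros]: "tdf f \<Longrightarrow> tdf g \<Longrightarrow> tdf (\<lambda>e. f e * g e)"
  by (rule tdf_fun2) (rule dfn_atomic)

lemma dfn_If:
  "dfn P \<Longrightarrow> dfn Q \<Longrightarrow> dfn R \<Longrightarrow> dfn (\<lambda>e. if P e then Q e else R e)"
  unfolding if_bool_eq_conj by (intro dfn_intros)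

lemma tdf_If [dfn_intros]:
  assumes "dfn P" "tdf f" "tdf g"
  shows "tdf (\<lambda>e. if P e then f e else g e)"
proof -
  have "dfn (\<lambda>e. if P (\<lambda>n. e (Suc n)) then e 0 = f (\<lambda>n. e (Suc n)) else e 0 = g (\<lambda>n. e (Suc n)))"
    by (intro dfn_If dfn_subst[OF assms(1)] tdfD[OF assms(2)] tdfD[OF assms(3)])
  then show ?thesis unfolding tdf_def by (simp add: if_distrib)
qed

lemma dfn_dvd [dfn_intros]: "tdf f \<Longrightarrow> tdf g \<Longrightarrow> dfn (\<lambda>e. f e dvd g e)"
  by (rule dfn_rel2[of "(dvd)"], unfold dvd_def) (intro dfn_intros)

text \<open>The form in which the induction scheme is used from here on: definability supplies the
  formula and its parameters.\<close>

lemma dfn_induct: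
  assumes "dfn (\<lambda>e. P (e 0))" "P 0" "\<And>x. P x \<Longrightarrow> P (x + 1)"
  shows "P x"
proof -
  obtain \<phi> p where 1: "\<And>e. P (e 0) = sat (env_join p e) \<phi>"
    using assms(1) unfolding dfn_def by blast
  have 2: "(env_join p (\<lambda>_. 0))(0 := x) = env_join p ((\<lambda>_. 0)(0 := x))" for x
    by (rule ext) (auto simp: env_join_def elim!: evenE)
  have 3: "P x = sat ((env_join p (\<lambda>_. 0))(0 := x)) \<phi>" for x
    using 1[of "(\<lambda>_. 0)(0 := x)"] unfolding 2 by simp
  show ?thesis using PA_induct[of "env_join p (\<lambda>_. 0)" 0 \<phi> x] assms(2,3) unfolding 3[symmetric] by blast
qed

section \<open>Arithmetic and Cantor pairing\<close>

text \<open>This and the following instances open the library rules on cancellation and order to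
  every model.\<close>

instance peano_model \<subseteq> cancel_semigroup_add
proof
  fix a b c :: 'a
  show *: "b + a = c + a \<Longrightarrow> b = c" for a b c :: 'a
    using PA_add_strict_mono[of b c a] PA_add_strict_mono[of c b a]
    by (cases b c rule: linorder_cases) auto
  show "a + b = a + c \<Longrightarrow> b = c" using *[of b a c] by (simp add: add.commute)
qed

lemma PA_less_add_right: "x < x + y \<or> y = (0::'a::peano_model)"
  using PA_zero_least[of y] PA_add_strict_mono[of 0 y x] by (auto simp: le_less add.commute)

instance peano_model \<subseteq> canonically_ordered_monoid_add
proof
  fix a b :: 'a
  show "a \<le> b \<longleftrightarrow> (\<exists>c. b = a + c)"
    using PA_less_add_right[of a] PA_less_imp_add[of a b] by (metis add_0_right le_less order_refl)
qed

instance peano_model \<subseteq> strict_ordered_ab_semigroup_add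
proof
  fix a b c d :: 'a
  show "a < b \<Longrightarrow> c < d \<Longrightarrow> a + c < b + d"
    using PA_add_strict_mono[of a b c] add_left_mono[of c d b] less_le_trans by (metis less_imp_le)
qed

instance peano_model \<subseteq> ordered_comm_semiring
proof
  fix a b c :: 'a
  assume "a \<le> b" "0 \<le> c"
  then show "c * a \<le> c * b"
    using PA_mult_strict_mono[of c a b] by (auto simp: le_less mult.commute)
qed

instance peano_model \<subseteq> linordered_nonzero_semiring
proof
  fix a b :: 'a
  show "(0::'a) < 1" by (rule PA_zero_less_one)
  show "a < b \<Longrightarrow> a + 1 < b + 1" by (rule PA_add_strict_mono)
qed

instance peano_model \<subseteq> semiring_no_zero_divisors_cancel
proof
  fix a b c :: 'a
  have *: "a * c = b * c \<Longrightarrow> c = 0 \<or> a = b" for a b c :: 'a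
    using PA_mult_strict_mono[of c a b] PA_mult_strict_mono[of c b a] zero_le[of c]
    by (cases a b rule: linorder_cases) (auto simp: le_less)
  show 1: "a * c = b * c \<longleftrightarrow> c = 0 \<or> a = b" for a b c :: 'a using * by auto
  show "c * a = c * b \<longleftrightarrow> c = 0 \<or> a = b" using 1[of a c b] by (simp add: mult.commute)
  show "a \<noteq> 0 \<Longrightarrow> b \<noteq> 0 \<Longrightarrow> a * b \<noteq> 0" using *[of a b 0] by auto
qed

lemma PA_add_less_cancel [simp]:
  fixes a b c :: "'a::peano_model"
  shows "a + c < b + c \<longleftrightarrow> a < b" "c + a < c + b \<longleftrightarrow> a < b"
    "a + c \<le> b + c \<longleftrightarrow> a \<le> b" "c + a \<le> c + b \<longleftrightarrow> a \<le> b"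
  using PA_add_strict_mono[of a b c] PA_add_strict_mono[of b a c]
  by (cases a b rule: linorder_cases; auto simp: add.commute)+

lemma PA_less_add_one [simp]: "x < y + 1 \<longleftrightarrow> x \<le> (y::'a::peano_model)"
proof
  assume "x \<le> y"
  then show "x < y + 1" using PA_less_add_right[of y 1] by auto
next
  assume "x < y + 1"
  show "x \<le> y"
  proof (rule ccontr)
    assume "\<not> x \<le> y"
    then obtain z where z: "y + z = x" using PA_less_imp_add[of y x] by (auto simp: not_le)
    then have "1 \<le> z" using PA_discrete[of z] zero_le[of z] \<open>\<not> x \<le> y\<close> by (auto simp: le_less)
    then show False using \<open>x < y + 1\<close> z by auto
  qed
qed

lemma PA_add_one_le [simp]: "x + 1 \<le> y \<longleftrightarrow> x < (y::'a::peano_model)"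
  using PA_less_add_one[of y x] by (simp add: not_less [symmetric])

lemma PA_obtain_pred:
  assumes "x \<noteq> (0::'a::peano_model)" obtains y where "x = y + 1"
  using PA_less_imp_add[of 0 x] PA_add_one_le[of 0 x] assms zero_le[of x]
  by (metis add.commute add_0_left le_iff_add order_le_less)

lemma PA_obtain_less:
  assumes "x < (y::'a::peano_model)" obtains z where "y = x + 1 + z"
  using assms PA_add_one_le[of x y] unfolding le_iff_add by blast

lemma PA_division: 
  assumes "0 < (m::'a::peano_model)" shows "\<exists>q r. u = q * m + r \<and> r < m"
proof (rule dfn_induct[of "\<lambda>u. \<exists>q r. u = q * m + r \<and> r < m"])
  show "dfn (\<lambda>e. \<exists>q r. e 0 = q * m + r \<and> r < m)" by (intro dfn_intros)
  show "\<exists>q r. 0 = q * m + r \<and> r < m" using assms by (intro exI[of _ 0]) simp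
  fix x assume "\<exists>q r. x = q * m + r \<and> r < m"
  then obtain q r where qr: "x = q * m + r" "r < m" by blast
  show "\<exists>q r. x + 1 = q * m + r \<and> r < m"
  proof (cases "r + 1 = m")
    case True
    then show ?thesis using qr assms
      by - (rule exI[of _ "q + 1"], rule exI[of _ 0], auto simp: algebra_simps)
  next
    case False
    then have "r + 1 < m" using qr(2) PA_add_one_le[of r m] by (simp add: le_less)
    then show ?thesis using qr
      by - (rule exI[of _ "q"], rule exI[of _ "r + 1"], simp add: algebra_simps)
  qed
qed

lemma PA_division_unique:
  fixes m :: "'a::peano_model"
  assumes "q * m + r = q' * m + r'" "r < m" "r' < m"
  shows "q = q'" "r = r'"
proof -
  have *: False if c: "q * m + r = q' * m + r'" "r < m" "q < q'" for q q' r r'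
  proof -
    obtain z where "q' = q + 1 + z" using PA_obtain_less[OF c(3)] .
    then have "q * m + r = q * m + (m + (z * m + r'))" using c(1) by (simp add: algebra_simps)
    then have "m \<le> r" unfolding le_iff_add by auto
    then show False using c(2) by simp
  qed
  show "q = q'" using *[of q r q' r'] *[of q' r' q r] assms by (cases q q' rule: linorder_cases) auto
  then show "r = r'" using assms by simp
qed

section \<open>Cantor pairing\<close>

definition cpair :: "'a::peano_model \<Rightarrow> 'a \<Rightarrow> 'a \<Rightarrow> bool" where
  "cpair a u v \<longleftrightarrow> 2 * a = (u + v) * (u + v + 1) + 2 * v"

text \<open>Induction on \<open>a\<close> walks along the diagonals: from \<open>(w + 1, v)\<close>
  to \<open>(w, v + 1)\<close>, and from \<open>(0, v)\<close> to the start
  \<open>(v + 1, 0)\<close> of the next diagonal.\<close>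

lemma cpair_ex: "\<exists>u v. cpair (a::'a::peano_model) u v"
  unfolding cpair_def
proof (rule dfn_induct[of "\<lambda>a. \<exists>u v. 2 * a = (u + v) * (u + v + 1) + 2 * v"])
  show "dfn (\<lambda>e::nat\<Rightarrow>'a. \<exists>u v. 2 * e 0 = (u + v) * (u + v + 1) + 2 * v)"
    by (intro dfn_intros)
  show "\<exists>u v. 2 * 0 = (u + v) * (u + v + (1::'a)) + 2 * v"
    by (intro exI[of _ 0]) simp
  fix a :: 'a assume "\<exists>u v. 2 * a = (u + v) * (u + v + 1) + 2 * v"
  then obtain u v where uv: "2 * a = (u + v) * (u + v + 1) + 2 * v" by blast
  then have 1: "2 * (a + 1) = (u + v) * (u + v + 1) + 2 * v + 2" by (simp add: algebra_simps)
  show "\<exists>u v. 2 * (a + 1) = (u + v) * (u + v + 1) + 2 * v"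
  proof (cases "u = 0")
    case True
    then show ?thesis unfolding 1
      by - (rule exI[of _ "v + 1"], rule exI[of _ 0], simp add: algebra_simps flip: one_add_one)
  next
    case False
    then obtain w where "u = w + 1" by (rule PA_obtain_pred)
    then show ?thesis unfolding 1
      by - (rule exI[of _ "w"], rule exI[of _ "v + 1"], simp add: algebra_simps flip: one_add_one)
  qed
qed

lemma PA_two_neq_zero [simp]: "(2::'a::peano_model) \<noteq> 0"
  by (metis add_eq_0_iff_both_eq_0 one_add_one zero_neq_one)

text \<open>With \<open>w = u + v\<close>, the doubled code lies between \<open>w * (w + 1)\<close>
  and \<open>(w + 1) * (w + 2)\<close>, where the next diagonal starts. So the code fixes
  \<open>w\<close>, then \<open>v\<close>, then \<open>u\<close>.\<close>

lemma cpair_unique: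
  fixes a :: "'a::peano_model"
  assumes "cpair a u v" "cpair a u' v'" shows "u = u'" "v = v'"
proof -
  have *: False if c: "cpair a u v" "cpair a u' v'" "u + v < u' + v'" for u v u' v'
  proof -
    obtain z where z: "u' + v' = u + v + 1 + z" using PA_obtain_less[OF c(3)] .
    have "(u + v) * (u + v + 1) + 2 * v < (u + v + 1) * (u + v + 1 + 1)"
    proof -
      have "(u + v + 1) * (u + v + 1 + 1) = (u + v) * (u + v + 1) + 2 * v + (2 * u + 1 + 1)"
        by (simp add: algebra_simps flip: one_add_one)
      moreover have "x < x + (y + 1 + 1)" for x y :: 'a
        using PA_less_add_one[of x "x + y + 1"] by (simp add: le_iff_add add.assoc)
      ultimately show ?thesis by simp
    qed
    also have "\<dots> \<le> (u' + v') * (u' + v' + 1)" unfolding z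
      by (intro mult_mono) (auto simp: le_iff_add algebra_simps)
    also have "\<dots> \<le> (u' + v') * (u' + v' + 1) + 2 * v'" by (simp add: le_iff_add)
    finally show False using c(1,2) unfolding cpair_def by auto
  qed
  have s: "u + v = u' + v'" using *[OF assms] *[OF assms(2,1)] by (cases "u + v" "u' + v'" rule: linorder_cases) auto
  then have "2 * v = 2 * v'" using assms unfolding cpair_def by simp
  then show "v = v'" by simp
  then show "u = u'" using s by simp
qed

lemma PA_double_le: "x \<le> y" if "2 * x \<le> 2 * (y::'a::peano_model)"
proof (rule ccontr)
  assume "\<not> x \<le> y"
  then have "y * 2 < x * 2" by (intro PA_mult_strict_mono) (auto simp: less_le)
  then show False using that by (simp add: mult.commute)
qed

lemma PA_even_mult_Suc: "\<exists>h. 2 * h = w * (w + (1::'a::peano_model))"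
proof (rule dfn_induct[of "\<lambda>w. \<exists>h. 2 * h = w * (w + 1)"])
  show "dfn (\<lambda>e::nat\<Rightarrow>'a. \<exists>h. 2 * h = e 0 * (e 0 + 1))" by (intro dfn_intros)
  show "\<exists>h. 2 * h = 0 * (0 + (1::'a))" by (intro exI[of _ 0]) simp
  fix w :: 'a assume "\<exists>h. 2 * h = w * (w + 1)"
  then obtain h where h: "2 * h = w * (w + 1)" by blast
  have "2 * (h + w + 1) = 2 * h + 2 * w + 2" by (simp add: algebra_simps)
  then have "2 * (h + w + 1) = (w + 1) * (w + 1 + 1)"
    unfolding h by (simp add: algebra_simps flip: one_add_one)
  then show "\<exists>h. 2 * h = (w + 1) * (w + 1 + 1)" by blast
qed

lemma cpair_total: "\<exists>a. cpair a u (v::'a::peano_model)"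
proof -
  obtain h where "2 * h = (u + v) * (u + v + 1)" using PA_even_mult_Suc by blast
  then show ?thesis unfolding cpair_def by (intro exI[of _ "h + v"]) (simp add: distrib_left)
qed

lemma cpair_inj: "cpair a u v \<Longrightarrow> cpair a' u v \<Longrightarrow> a = (a'::'a::peano_model)"
  unfolding cpair_def by (metis PA_two_neq_zero mult_cancel_left)

definition pr :: "'a::peano_model \<Rightarrow> 'a \<Rightarrow> 'a" where "pr u v = (THE a. cpair a u v)"
definition cfst :: "'a::peano_model \<Rightarrow> 'a" where "cfst a = (THE u. \<exists>v. cpair a u v)"
definition csnd :: "'a::peano_model \<Rightarrow> 'a" where "csnd a = (THE v. \<exists>u. cpair a u v)"

lemma cpair_iff_pr: "cpair a u v \<longleftrightarrow> a = pr u v"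
  unfolding pr_def using cpair_total[of u v] cpair_inj by (metis theI)

lemma cfst_pr [simp]: "cfst (pr u v) = u" and csnd_pr [simp]: "csnd (pr u v) = v"
  unfolding cfst_def csnd_def using cpair_unique[of "pr u v"] cpair_iff_pr[of "pr u v" u v]
  by (auto intro!: the_equality)

lemma pr_cfst_csnd [simp]: "pr (cfst a) (csnd a) = a"
  using cpair_ex[of a] by (auto simp: cpair_iff_pr)

lemma dfn_cpair: "dfn (\<lambda>e. cpair (e i) (e j) (e k))"
  unfolding cpair_def by (intro dfn_intros)

lemma tdf_pr [dfn_intros]: "tdf f \<Longrightarrow> tdf g \<Longrightarrow> tdf (\<lambda>e. pr (f e) (g e))"
  by (rule tdf_fun2) (auto simp flip: cpair_iff_pr intro: dfn_cpair)

lemma tdf_cfst [dfn_intros]: assumes "tdf f" shows "tdf (\<lambda>e. cfst (f e))"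
proof (rule tdf_fun1[OF _ assms])
  have "dfn (\<lambda>e::nat\<Rightarrow>'a. \<exists>v. e 1 = pr (e 0) v)" by (intro dfn_intros)
  moreover have "(\<exists>v. y = pr x v) \<longleftrightarrow> x = cfst y" for x y :: 'a
    by (metis cfst_pr pr_cfst_csnd)
  ultimately show "dfn (\<lambda>e::nat\<Rightarrow>'a. e 0 = cfst (e 1))" by simp
qed

lemma tdf_csnd [dfn_intros]: assumes "tdf f" shows "tdf (\<lambda>e. csnd (f e))"
proof (rule tdf_fun1[OF _ assms])
  have "dfn (\<lambda>e::nat\<Rightarrow>'a. \<exists>v. e 1 = pr v (e 0))" by (intro dfn_intros)
  moreover have "(\<exists>v. y = pr v x) \<longleftrightarrow> x = csnd y" for x y :: 'a
    by (metis csnd_pr pr_cfst_csnd)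
  ultimately show "dfn (\<lambda>e::nat\<Rightarrow>'a. e 0 = csnd (e 1))" by simp
qed

lemma pr_ge: "u + v \<le> pr u v" "v \<le> pr u v" "u \<le> pr u v"
proof -
  have "2 * pr u v = (u + v) * (u + v + 1) + 2 * v" 
    using cpair_iff_pr[of "pr u v" u v] unfolding cpair_def by simp
  moreover obtain h where h: "2 * h = (u + v) * (u + v + 1)" using PA_even_mult_Suc by blast
  ultimately have "2 * pr u v = 2 * (h + v)" by (simp only: distrib_left)
  then have p: "pr u v = h + v" by (simp only: mult_cancel_left PA_two_neq_zero) simp
  then show "v \<le> pr u v" by (simp add: le_iff_add add.commute)
  have "2 * (u + v) \<le> 2 * h"
  proof (cases "u + v = 0")
    case False
    then obtain z where z: "u + v = z + 1" by (rule PA_obtain_pred)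
    show ?thesis unfolding h z
      by (auto simp: le_iff_add algebra_simps intro!: exI[of _ "z + z*z"] simp flip: one_add_one)
  qed simp
  then have "u + v \<le> h" by (rule PA_double_le)
  also have "h \<le> pr u v" unfolding p by (simp add: le_iff_add)
  finally show *: "u + v \<le> pr u v" .
  then show "u \<le> pr u v" by (metis le_iff_add order_trans)
qed

lemma cfst_le: "cfst s \<le> (s::'a::peano_model)" and csnd_le: "csnd s \<le> s"
  using pr_ge(2,3)[where u="cfst s" and v="csnd s"] by simp_all

text \<open>Makes the operands of an evaluator index with nonzero tag smaller than the index
  itself.\<close>

lemma pr_greater: "u \<noteq> 0 \<Longrightarrow> v < pr u v"
  using pr_ge(1)[of u v] PA_less_add_right[of v u] by (metis add.commute less_le_trans)

text \<open>A polynomial bound, so that initial segments closed under sum and product are closed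
  under pairing.\<close>

lemma pr_le: "pr u v \<le> (u + v + 1) * (u + v + 1)"
proof (rule PA_double_le)
  have "2 * pr u v = (u + v) * (u + v + 1) + 2 * v" 
    using cpair_iff_pr[of "pr u v" u v] unfolding cpair_def by simp
  also have "\<dots> \<le> (u + v + 1) * (u + v + 1) + (u + v + 1) * (u + v + 1)"
  proof (rule add_mono)
    show "(u + v) * (u + v + 1) \<le> (u + v + 1) * (u + v + 1)"
      by (intro mult_right_mono) (auto simp: le_iff_add)
    have "(u + v + 1) * (u + v + 1) = 2 * v + (2 * u + (u + v) * (u + v) + 1)"
      by (simp add: algebra_simps mult_2 mult_2_right)
    then show "2 * v \<le> (u + v + 1) * (u + v + 1)" unfolding le_iff_add by blast
  qed
  also have "\<dots> = 2 * ((u + v + 1) * (u + v + 1))" by (simp only: mult_2)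
  finally show "2 * pr u v \<le> 2 * ((u + v + 1) * (u + v + 1))" .
qed

text \<open>The definite description is resolved by unique pairing components and by division with
  remainder, the modulus being positive.\<close>

lemma seq_nth_iff:
  "seq_nth a i = r \<longleftrightarrow>
    (\<exists>q. cfst a = q * (1 + (i + 1) * csnd a) + r) \<and> r < 1 + (i + 1) * csnd (a::'a::peano_model)"
proof -
  let ?m = "1 + (i + 1) * csnd a"
  let ?P = "\<lambda>r. \<exists>q. cfst a = q * ?m + r \<and> r < ?m"
  have "0 < ?m" by (metis PA_less_add_one add.commute zero_le)
  then have ex: "\<exists>r. ?P r" using PA_division by blast
  then obtain r0 where r0: "?P r0" by blast
  have un: "r = r'" if P: "?P r" "?P r'" for r r'
  proof -
    obtain q q' where "cfst a = q * ?m + r" "r < ?m" "cfst a = q' * ?m + r'" "r' < ?m"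
      using P by blast
    then show ?thesis using PA_division_unique(2)[of q ?m r q' r'] by simp
  qed
  have "(\<exists>u v q. 2 * a = (u + v) * (u + v + 1) + 2 * v \<and>
     u = q * (1 + (i + 1) * v) + r \<and> r < 1 + (i + 1) * v) \<longleftrightarrow> ?P r" for r
  proof -
    have "cpair a u v \<longleftrightarrow> u = cfst a \<and> v = csnd a" for u v
      unfolding cpair_iff_pr by (metis cfst_pr csnd_pr pr_cfst_csnd)
    then show ?thesis unfolding cpair_def by auto
  qed
  then have "seq_nth a i = (THE r. ?P r)" unfolding seq_nth_def by simp
  also have "\<dots> = r0" using r0 un by (intro the_equality) blast+
  finally have "seq_nth a i = r0" .
  then have "seq_nth a i = r \<longleftrightarrow> ?P r" using r0 un by blast
  then show ?thesis by blast
qed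

lemma tdf_seq_nth [dfn_intros]:
  assumes "tdf f" "tdf g" shows "tdf (\<lambda>e. seq_nth (f e) (g e))"
proof (rule tdf_fun2[OF _ assms])
  have "dfn (\<lambda>e::nat\<Rightarrow>'a. seq_nth (e 1) (e 2) = e 0)" unfolding seq_nth_iff
    by (intro dfn_intros)
  then show "dfn (\<lambda>e::nat\<Rightarrow>'a. e 0 = seq_nth (e 1) (e 2))" by (simp add: eq_commute)
qed

section \<open>The beta lemma and coding\<close>

lemma PA_less_Suc_cases:
  assumes "i < N + (1::'a::peano_model)" obtains "i < N" | "i = N"
  using assms by (auto simp: le_less)

lemma tdf_comp: "tdf (\<lambda>e. F (e 0)) \<Longrightarrow> tdf f \<Longrightarrow> tdf (\<lambda>e. F (f e))"
  by (rule tdf_fun1) (simp add: tdf_def)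

text \<open>Collection for a definable function; \<open>beta_lemma\<close> uses the bound to make
  its moduli exceed all values to be coded.\<close>

lemma definable_bounded:
  fixes F :: "'a::peano_model \<Rightarrow> 'a"
  assumes F: "tdf (\<lambda>e. F (e 0))"
  shows "\<exists>B. \<forall>i<N. F i \<le> B"
proof (rule dfn_induct[of "\<lambda>N. \<exists>B. \<forall>i<N. F i \<le> B"])
  show "dfn (\<lambda>e. \<exists>B. \<forall>i<e 0. F i \<le> B)" by (intro dfn_intros tdf_comp[OF F])
  show "\<exists>B. \<forall>i<0. F i \<le> B" by simp
  fix N assume "\<exists>B. \<forall>i<N. F i \<le> B"
  then obtain B where B: "\<And>i. i < N \<Longrightarrow> F i \<le> B" by blast
  have "F i \<le> max B (F N)" if "i < N + 1" for i
    using B[of i] by (auto intro: PA_less_Suc_cases[OF that] simp: le_max_iff_disj)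
  then show "\<exists>B. \<forall>i<N + 1. F i \<le> B" by blast
qed

text \<open>Stands in for the factorial of \<open>N\<close>, whose definition would already require
  coded sequences.\<close>

lemma common_multiple:
  "\<exists>v. v \<noteq> 0 \<and> (\<forall>k. k \<noteq> 0 \<longrightarrow> k \<le> N \<longrightarrow> k dvd (v::'a::peano_model))"
proof (rule dfn_induct[of "\<lambda>N. \<exists>v. v \<noteq> 0 \<and> (\<forall>k. k \<noteq> 0 \<longrightarrow> k \<le> N \<longrightarrow> k dvd v)"])
  show "dfn (\<lambda>e. \<exists>v. v \<noteq> (0::'a) \<and> (\<forall>k. k \<noteq> 0 \<longrightarrow> k \<le> e 0 \<longrightarrow> k dvd v))"
    by (intro dfn_intros)
  show "\<exists>v. v \<noteq> (0::'a) \<and> (\<forall>k. k \<noteq> 0 \<longrightarrow> k \<le> 0 \<longrightarrow> k dvd v)"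
    by (intro exI[of _ 1]) simp
  fix N :: 'a assume "\<exists>v. v \<noteq> 0 \<and> (\<forall>k. k \<noteq> 0 \<longrightarrow> k \<le> N \<longrightarrow> k dvd v)"
  then obtain v where v: "v \<noteq> 0" "\<And>k. k \<noteq> 0 \<Longrightarrow> k \<le> N \<Longrightarrow> k dvd v" by blast
  have "k dvd v * (N + 1)" if "k \<noteq> 0" "k \<le> N + 1" for k
  proof (cases "k = N + 1")
    case False
    then have "k < N + 1" using that(2) by (simp add: less_le del: PA_less_add_one)
    then show ?thesis using v(2)[of k] that(1) by (simp add: dvd_mult2)
  qed simp
  then show "\<exists>v. v \<noteq> 0 \<and> (\<forall>k. k \<noteq> 0 \<longrightarrow> k \<le> N + 1 \<longrightarrow> k dvd v)"
    using v(1) by (intro exI[of _ "v * (N + 1)"]) simp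
qed

text \<open>Coprimality is expressed by one-sided Bezout identities \<open>s * x = 1 + t * m\<close>, which avoid
  subtraction.  The one below rests on \<open>(j + 1) m\<^sub>i - (i + 1) m\<^sub>j = j - i\<close>, where
  \<open>m\<^sub>i = 1 + (i + 1) v\<close> and \<open>j - i\<close> divides \<open>v\<close>.\<close>

lemma beta_moduli_coprime:
  fixes v :: "'a::peano_model"
  assumes "v \<noteq> 0" "\<And>k. k \<noteq> 0 \<Longrightarrow> k \<le> N \<Longrightarrow> k dvd v" "i < j" "j \<le> N"
  shows "\<exists>s t. s * (1 + (i + 1) * v) = 1 + t * (1 + (j + 1) * v)"
proof -
  obtain d where d: "j = i + 1 + d" using PA_obtain_less[OF assms(3)] .
  have "1 + d \<le> j" unfolding d le_iff_add by (metis add.assoc add.commute)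
  then have "(1 + d) dvd v" using assms(2)[of "1 + d"] assms(4) by auto
  then obtain w where w: "v = (1 + d) * w" unfolding dvd_def by blast
  have "(j + 1) * v \<noteq> 0" using assms(1) by simp
  then obtain y where y: "(j + 1) * v = y + 1" by (rule PA_obtain_pred)
  let ?m = "1 + (j + 1) * v" and ?c = "(j + 1) * v * (j + 1) * w"
  have "?c * (j + 1) * (1 + (i + 1) * v) = ?c * ((1 + d) + (i + 1) * ?m)"
    unfolding d by (simp add: algebra_simps)
  also have "\<dots> = (j + 1) * v * ((j + 1) * ((1 + d) * w)) + ?c * (i + 1) * ?m"
    by (simp add: algebra_simps)
  also have "\<dots> = (y + 1) * (y + 1) + ?c * (i + 1) * ?m"
    unfolding w[symmetric] y ..
  also have "(y + 1) * (y + 1) = 1 + y * (1 + (y + 1))" by (simp add: algebra_simps)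
  also have "1 + y * (1 + (y + 1)) + ?c * (i + 1) * ?m = 1 + (y + ?c * (i + 1)) * ?m"
    unfolding y by (simp add: algebra_simps)
  finally show ?thesis by blast
qed

lemma chinese_remainder_beta:
  fixes v :: "'a::peano_model" and F :: "'a \<Rightarrow> 'a"
  assumes v: "v \<noteq> 0" "\<And>k. k \<noteq> 0 \<Longrightarrow> k \<le> N \<Longrightarrow> k dvd v" and F: "tdf (\<lambda>e. F (e 0))"
  shows "\<exists>u. \<forall>i<N. \<exists>q. u = q * (1 + (i + 1) * v) + F i"
proof -
  let ?m = "\<lambda>i. 1 + (i + 1) * v"
  \<comment> \<open>The invariant: \<open>p\<close> is a common multiple of the first
    \<open>k\<close> moduli, \<open>u\<close> solves the first \<open>k\<close> congruences, and
    \<open>p\<close> is invertible modulo each remaining modulus.\<close>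
  let ?A = "\<lambda>k u p. (\<forall>i. i < k \<longrightarrow> (\<exists>q. p = q * ?m i) \<and> (\<exists>q. u = q * ?m i + F i)) \<and>
      (\<forall>j. k \<le> j \<longrightarrow> j < N \<longrightarrow> (\<exists>s t. s * p = 1 + t * ?m j))"
  have "k \<le> N \<longrightarrow> (\<exists>u p. ?A k u p)" for k
  proof (rule dfn_induct[of "\<lambda>k. k \<le> N \<longrightarrow> (\<exists>u p. ?A k u p)"])
    show "dfn (\<lambda>e. e 0 \<le> N \<longrightarrow> (\<exists>u p. ?A (e 0) u p))"
      by (intro dfn_intros tdf_comp[OF F])
    have "s * 1 = 1 + 0 * x" if "s = 1" for s x :: 'a using that by simp
    then have "?A 0 0 1" by auto
    then show "0 \<le> N \<longrightarrow> (\<exists>u p. ?A 0 u p)" by blast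
    fix k assume IH: "k \<le> N \<longrightarrow> (\<exists>u p. ?A k u p)"
    show "k + 1 \<le> N \<longrightarrow> (\<exists>u p. ?A (k + 1) u p)"
    proof
      assume "k + 1 \<le> N"
      then have kN: "k < N" by simp
      then obtain u p where
        p: "\<And>i. i < k \<Longrightarrow> \<exists>q. p = q * ?m i" and u: "\<And>i. i < k \<Longrightarrow> \<exists>q. u = q * ?m i + F i" and
        c: "\<And>j. k \<le> j \<Longrightarrow> j < N \<Longrightarrow> \<exists>s t. s * p = 1 + t * ?m j"
        using IH less_imp_le[OF kN] by blast
      obtain s t where st: "s * p = 1 + t * ?m k" using c[of k] kN by blast
      \<comment> \<open>Modulo \<open>?m k\<close>, \<open>(k + 1) * v\<close> is \<open>-1\<close>,
        so \<open>?y\<close> represents \<open>F k - u\<close> without subtraction. Since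
        \<open>s * p\<close> is \<open>1\<close> modulo \<open>?m k\<close>, \<open>?u\<close> is
        \<open>F k\<close> there; modulo earlier moduli it is still \<open>u\<close>.\<close>
      let ?y = "F k + (k + 1) * v * u"
      let ?u = "u + s * p * ?y"
      have "(\<exists>q. p * ?m k = q * ?m i) \<and> (\<exists>q. ?u = q * ?m i + F i)" if i: "i < k + 1" for i
      proof (cases "i = k")
        case True
        have "?u = (u + t * ?y) * ?m k + F k"
          unfolding st by (simp add: algebra_simps)
        then show ?thesis unfolding True by blast
      next
        case False
        then have "i < k" using PA_less_Suc_cases[OF i] by blast
        then obtain q q' where "p = q * ?m i" "u = q' * ?m i + F i" using p[of i] u[of i] by blast
        then have "p * ?m k = (q * ?m k) * ?m i" "?u = (q' + s * q * ?y) * ?m i + F i"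
          by (simp_all add: algebra_simps)
        then show ?thesis by blast
      qed
      moreover have "\<exists>s t. s * (p * ?m k) = 1 + t * ?m j" if j: "k + 1 \<le> j" "j < N" for j
      proof -
        have kj: "k < j" using j(1) by simp
        obtain s1 t1 where 1: "s1 * p = 1 + t1 * ?m j" using c[OF less_imp_le[OF kj] j(2)] by blast
        obtain s2 t2 where 2: "s2 * ?m k = 1 + t2 * ?m j"
          using beta_moduli_coprime[OF v kj less_imp_le[OF j(2)]] by blast
        have "(s1 * s2) * (p * ?m k) = (s1 * p) * (s2 * ?m k)"
          by (simp only: mult.assoc mult.left_commute)
        also have "\<dots> = 1 + (t1 + t2 + t1 * t2 * ?m j) * ?m j"
          unfolding 1 2 by (simp add: algebra_simps)
        finally show ?thesis by blast
      qed
      ultimately have "?A (k + 1) ?u (p * ?m k)" by blast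
      then show "\<exists>u p. ?A (k + 1) u p" by blast
    qed
  qed
  from this[of N] show ?thesis by blast
qed

lemma beta_lemma:
  fixes F :: "'a::peano_model \<Rightarrow> 'a"
  assumes F: "tdf (\<lambda>e. F (e 0))"
  shows "\<exists>a. \<forall>i<N. seq_nth a i = F i"
proof -
  obtain B where B: "\<And>i. i < N \<Longrightarrow> F i \<le> B" using definable_bounded[OF F] by blast
  obtain v0 where v0: "v0 \<noteq> 0" "\<And>k. k \<noteq> 0 \<Longrightarrow> k \<le> N \<Longrightarrow> k dvd v0"
    using common_multiple[of N] by blast
  \<comment> \<open>The factor \<open>B + 1\<close> makes every modulus larger than
    \<open>B\<close>, so each \<open>F i\<close> is itself the remainder.\<close>
  let ?v = "v0 * (B + 1)"
  have v: "?v \<noteq> 0" "\<And>k. k \<noteq> 0 \<Longrightarrow> k \<le> N \<Longrightarrow> k dvd ?v"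
    using v0 by (simp_all add: dvd_mult2)
  obtain u where u: "\<And>i. i < N \<Longrightarrow> \<exists>q. u = q * (1 + (i + 1) * ?v) + F i"
    using chinese_remainder_beta[OF v F] by blast
  have "seq_nth (pr u ?v) i = F i" if i: "i < N" for i
  proof -
    obtain z where z: "v0 = z + 1" using v0(1) by (rule PA_obtain_pred)
    have "F i \<le> B" by (rule B[OF i])
    also have "B \<le> (i + 1) * ?v" unfolding z le_iff_add
      by (rule exI[of _ "1 + z * (B + 1) + i * ?v"]) (simp add: z algebra_simps)
    finally have "F i < (i + 1) * ?v + 1" by simp
    then show ?thesis unfolding seq_nth_iff cfst_pr csnd_pr using u[OF i] by (simp add: add.commute)
  qed
  then show ?thesis by blast
qed

lemma seq_extend:
  fixes s :: "'a::peano_model"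
  shows "\<exists>s'. (\<forall>i<k. seq_nth s' i = seq_nth s i) \<and> seq_nth s' k = y"
proof -
  have "tdf (\<lambda>e. if e 0 < k then seq_nth s (e 0) else y)" by (intro dfn_intros)
  from beta_lemma[of "\<lambda>i. if i < k then seq_nth s i else y", OF this, of "k + 1"]
  obtain s' where s': "\<And>i. i < k + 1 \<Longrightarrow> seq_nth s' i = (if i < k then seq_nth s i else y)" by blast
  then show ?thesis using s'[of k] by (intro exI[of _ s']) (auto simp: less_imp_le)
qed

text \<open>Recursion inside the model. By \<open>local\<close>, step \<open>k\<close> sees only
  entries below \<open>k\<close>, so replacing the code by an extension keeps the earlier steps
  valid.\<close>

lemma dependent_choice:
  fixes N :: "'a::peano_model"
  assumes R: "dfn (\<lambda>e. R (e 0) (e 1) (e 2))"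
    and total: "\<And>s k. \<exists>y. R s k y"
    and local: "\<And>s s' k y. (\<And>i. i < k \<Longrightarrow> seq_nth s i = seq_nth s' i) \<Longrightarrow> R s k y \<Longrightarrow> R s' k y"
  shows "\<exists>s. \<forall>k<N. R s k (seq_nth s k)"
proof (rule dfn_induct[of "\<lambda>N. \<exists>s. \<forall>k<N. R s k (seq_nth s k)"])
  show "dfn (\<lambda>e. \<exists>s. \<forall>k<e 0. R s k (seq_nth s k))"
    by (intro dfn_intros dfn_rel3[OF R])
  show "\<exists>s. \<forall>k<0. R s k (seq_nth s k)" by simp
  fix N assume "\<exists>s. \<forall>k<N. R s k (seq_nth s k)"
  then obtain s where s: "\<And>k. k < N \<Longrightarrow> R s k (seq_nth s k)" by blast
  obtain y where y: "R s N y" using total by blast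
  obtain s' where s': "\<And>i. i < N \<Longrightarrow> seq_nth s' i = seq_nth s i" "seq_nth s' N = y"
    using seq_extend[of N s y] by blast
  have "R s' k (seq_nth s' k)" if "k < N + 1" for k
  proof (rule local[of k s])
    show "seq_nth s i = seq_nth s' i" if "i < k" for i
      using s'(1)[of i] that \<open>k < N + 1\<close> by simp
    show "R s k (seq_nth s' k)"
      using s[of k] s'(1)[of k] s'(2) y by (auto intro: PA_less_Suc_cases[OF that])
  qed
  then show "\<exists>s. \<forall>k<N + 1. R s k (seq_nth s k)" by blast
qed

section \<open>Powers and Ackermann membership\<close>

lemma power_sequence:
  fixes c :: "'a::peano_model"
  shows "\<exists>s. seq_nth s 0 = 1 \<and> (\<forall>i<N. seq_nth s (i + 1) = c * seq_nth s i)"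
proof -
  let ?R = "\<lambda>s k y. (k = 0 \<longrightarrow> y = 1) \<and> (\<forall>i. k = i + 1 \<longrightarrow> y = c * seq_nth s i)"
  have "\<exists>s. \<forall>k<N + 1. ?R s k (seq_nth s k)"
  proof (rule dependent_choice[of ?R])
    show "dfn (\<lambda>e. ?R (e 0) (e 1) (e 2))" by (intro dfn_intros)
    show "\<exists>y. ?R s k y" for s k
    proof (cases "k = 0")
      case False
      then obtain i where "k = i + 1" by (rule PA_obtain_pred)
      then show ?thesis by (intro exI[of _ "c * seq_nth s i"]) simp
    qed simp
    show "?R s' k y" if "\<And>i. i < k \<Longrightarrow> seq_nth s i = seq_nth s' i" "?R s k y" for s s' k y
      using that by auto
  qed
  then obtain s where s: "\<And>k. k < N + 1 \<Longrightarrow> ?R s k (seq_nth s k)" by blast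
  then have "seq_nth s 0 = 1" using s[of 0] by simp
  moreover have "seq_nth s (i + 1) = c * seq_nth s i" if "i < N" for i
    using s[of "i + 1"] that by (simp only: PA_add_less_cancel)
  ultimately show ?thesis by blast
qed

lemma pow2_unique: 
  fixes x :: "'a::peano_model"
  assumes "pow2 x p" "pow2 x p'" shows "p = p'"
proof -
  obtain s s' where s: "seq_nth s 0 = 1" "\<And>i. i < x \<Longrightarrow> seq_nth s (i + 1) = 2 * seq_nth s i"
      "seq_nth s x = p"
    and s': "seq_nth s' 0 = 1" "\<And>i. i < x \<Longrightarrow> seq_nth s' (i + 1) = 2 * seq_nth s' i"
      "seq_nth s' x = p'" using assms unfolding pow2_def by blast
  have "i \<le> x \<longrightarrow> seq_nth s i = seq_nth s' i" for i
  proof (rule dfn_induct[of "\<lambda>i. i \<le> x \<longrightarrow> seq_nth s i = seq_nth s' i"])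
    show "dfn (\<lambda>e. e 0 \<le> x \<longrightarrow> seq_nth s (e 0) = seq_nth s' (e 0))" by (intro dfn_intros)
  qed (use s s' in auto)
  then show ?thesis using s s' by auto
qed

lemma pow2_ex: "\<exists>p. pow2 (x::'a::peano_model) p"
  using power_sequence[of x 2] unfolding pow2_def by blast

definition p2 :: "'a::peano_model \<Rightarrow> 'a" where "p2 x = (THE p. pow2 x p)"

lemma pow2_iff: "pow2 x p \<longleftrightarrow> p = p2 x"
  unfolding p2_def using pow2_ex[of x] pow2_unique[of x] by (metis theI)

lemma p2_0 [simp]: "p2 (0::'a::peano_model) = 1" and p2_Suc [simp]: "p2 ((x::'a) + 1) = 2 * p2 x"
proof -
  obtain s where s: "seq_nth s 0 = 1" "\<And>i. i < x + 1 \<Longrightarrow> seq_nth s (i + 1) = 2 * seq_nth s i"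
    using power_sequence[of "x + 1" 2] by blast
  have "pow2 0 (seq_nth s 0)" "pow2 x (seq_nth s x)" "pow2 (x + 1) (seq_nth s (x + 1))"
    unfolding pow2_def using s by (auto simp: less_imp_le)
  then show "p2 (0::'a) = 1" "p2 (x + 1) = 2 * p2 x" using s by (auto simp: pow2_iff)
qed

lemma tdf_p2 [dfn_intros]:
  assumes "tdf f" shows "tdf (\<lambda>e. p2 (f e))"
proof (rule tdf_fun1[OF _ assms])
  have "dfn (\<lambda>e::nat\<Rightarrow>'a. pow2 (e 1) (e 0))" unfolding pow2_def by (intro dfn_intros)
  then show "dfn (\<lambda>e::nat\<Rightarrow>'a. e 0 = p2 (e 1))" by (simp add: pow2_iff)
qed

lemma p2_pos: "p2 (x::'a::peano_model) \<noteq> 0"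
  by (rule dfn_induct[of "\<lambda>x. p2 x \<noteq> 0"]) (auto intro!: dfn_intros)

text \<open>Consequently adding \<open>p2 y\<close> changes the quotient by \<open>p2 x\<close> by
  an even number and leaves digit \<open>x\<close> alone.\<close>

lemma p2_double_dvd:
  assumes "x < (y::'a::peano_model)" shows "\<exists>k. p2 y = k * (2 * p2 x)"
proof -
  obtain z where y: "y = x + 1 + z" using PA_obtain_less[OF assms] .
  have "\<exists>k. p2 (x + 1 + z) = k * (2 * p2 x)"
  proof (rule dfn_induct[of "\<lambda>z. \<exists>k. p2 (x + 1 + z) = k * (2 * p2 x)"])
    show "dfn (\<lambda>e. \<exists>k. p2 (x + 1 + e 0) = k * (2 * p2 x))" by (intro dfn_intros)
    show "\<exists>k. p2 (x + 1 + 0) = k * (2 * p2 x)" by (intro exI[of _ 1]) simp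
    fix z assume "\<exists>k. p2 (x + 1 + z) = k * (2 * p2 x)"
    then obtain k where "p2 (x + 1 + z) = k * (2 * p2 x)" by blast
    then have "p2 (x + 1 + (z + 1)) = (2 * k) * (2 * p2 x)"
      using p2_Suc[of "x + 1 + z"] by (simp add: add.assoc mult.assoc)
    then show "\<exists>k. p2 (x + 1 + (z + 1)) = k * (2 * p2 x)" by blast
  qed
  then show ?thesis unfolding y .
qed

lemma mem_iff_p2: "mem x c \<longleftrightarrow> (\<exists>q r. r < p2 x \<and> c = (2 * q + 1) * p2 x + r)"
  unfolding mem_def pow2_iff by auto

lemma dfn_mem [dfn_intros]: "tdf f \<Longrightarrow> tdf g \<Longrightarrow> dfn (\<lambda>e. mem (f e) (g e))"
  by (rule dfn_rel2[of mem], unfold mem_iff_p2) (intro dfn_intros)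

lemma mem_iff_quotient_odd:
  assumes "r < p2 x" "c = Q * p2 x + r"
  shows "mem x c \<longleftrightarrow> (\<exists>q. Q = 2 * q + 1)"
  unfolding mem_iff_p2 assms(2) using assms(1) PA_division_unique(1)[of _ "p2 x"] by metis

lemma PA_odd_add_double:
  fixes Q :: "'a::peano_model"
  shows "(\<exists>q. Q + 2 * k = 2 * q + 1) \<longleftrightarrow> (\<exists>q. Q = 2 * q + 1)"
proof
  assume "\<exists>q. Q + 2 * k = 2 * q + 1"
  then obtain q where q: "Q + 2 * k = 2 * q + 1" by blast
  have "(0::'a) < 2" "(1::'a) < 2" by (simp_all flip: one_add_one)
  then obtain h b where h: "Q = h * 2 + b" "b < 2" using PA_division[of 2 Q] by blast
  have "(h + k) * 2 + b = q * 2 + 1" using q h by (simp add: algebra_simps)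
  then have "b = 1" using PA_division_unique(2) h(2) \<open>1 < 2\<close> by blast
  then show "\<exists>q. Q = 2 * q + 1" using h(1) by (auto simp: mult.commute)
next
  assume "\<exists>q. Q = 2 * q + 1"
  then obtain q where "Q = 2 * q + 1" by blast
  then have "Q + 2 * k = 2 * (q + k) + 1" by (simp add: algebra_simps)
  then show "\<exists>q. Q + 2 * k = 2 * q + 1" by blast
qed

lemma mem_add_p2: "i < N \<Longrightarrow> mem i (c + p2 N) \<longleftrightarrow> mem i c"
proof -
  assume "i < N"
  then obtain k where k: "p2 N = k * (2 * p2 i)" using p2_double_dvd by blast
  have "0 < p2 i" using p2_pos[of i] by (simp add: zero_less_iff_neq_zero)
  then obtain Q r where Qr: "c = Q * p2 i + r" "r < p2 i" using PA_division by blast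
  have "c + p2 N = (Q + 2 * k) * p2 i + r" unfolding k Qr by (simp add: algebra_simps)
  then show ?thesis
    using mem_iff_quotient_odd[OF Qr(2,1)] mem_iff_quotient_odd[OF Qr(2), of "c + p2 N" "Q + 2 * k"]
      PA_odd_add_double[of Q k] by simp
qed

text \<open>The bound \<open>c < p2 N\<close> strengthens the induction: it says that digit
  \<open>N\<close> is still \<open>0\<close>, so adding \<open>p2 N\<close> sets exactly this
  digit.\<close>

lemma mem_comprehension:
  fixes N :: "'a::peano_model"
  assumes P: "dfn (\<lambda>e. P (e 0))"
  shows "\<exists>c. c < p2 N \<and> (\<forall>i<N. mem i c \<longleftrightarrow> P i)"
proof (rule dfn_induct[of "\<lambda>N. \<exists>c. c < p2 N \<and> (\<forall>i<N. mem i c \<longleftrightarrow> P i)"])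
  show "dfn (\<lambda>e. \<exists>c. c < p2 (e 0) \<and> (\<forall>i<e 0. mem i c \<longleftrightarrow> P i))"
    by (intro dfn_intros dfn_rel1[OF P])
  show "\<exists>c. c < p2 0 \<and> (\<forall>i<0. mem i c \<longleftrightarrow> P i)" by (intro exI[of _ 0]) simp
  fix N assume "\<exists>c. c < p2 N \<and> (\<forall>i<N. mem i c \<longleftrightarrow> P i)"
  then obtain c where c: "c < p2 N" "\<And>i. i < N \<Longrightarrow> mem i c \<longleftrightarrow> P i" by blast
  have N: "p2 (N + 1) = p2 N + p2 N" by (simp add: mult_2)
  show "\<exists>c. c < p2 (N + 1) \<and> (\<forall>i<N + 1. mem i c \<longleftrightarrow> P i)"
  proof (cases "P N")
    case True
    have "mem N (c + p2 N)" unfolding mem_iff_p2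
      using c(1) by (intro exI[of _ 0] exI[of _ c]) (simp add: add.commute)
    then have "mem i (c + p2 N) \<longleftrightarrow> P i" if "i < N + 1" for i
      using True c(2)[of i] mem_add_p2[of i N c] by (auto intro: PA_less_Suc_cases[OF that])
    moreover have "c + p2 N < p2 (N + 1)" unfolding N using c(1) by simp
    ultimately show ?thesis by blast
  next
    case False
    have "p2 N \<le> (2 * q + 1) * p2 N + r" for q r :: 'a
      unfolding le_iff_add by (rule exI[of _ "2 * q * p2 N + r"]) (simp add: algebra_simps)
    then have "\<not> mem N c" unfolding mem_iff_p2 using c(1) by (auto simp: not_less[symmetric])
    then have "mem i c \<longleftrightarrow> P i" if "i < N + 1" for i
      using False c(2)[of i] by (auto intro: PA_less_Suc_cases[OF that])
    moreover have "c < p2 (N + 1)" unfolding N using c(1)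
      by (metis le_iff_add less_le_trans)
    ultimately show ?thesis by blast
  qed
qed

section \<open>Truth of bounded formulas\<close>

lemma nonstandard_greater:
  assumes "k \<notin> range of_nat" shows "of_nat n < (k::'a::peano_model)"
proof (induction n)
  case 0
  have "k \<noteq> of_nat 0" using assms by blast
  then show ?case by (simp add: zero_less_iff_neq_zero)
next
  case (Suc n)
  then have "of_nat n + 1 \<le> k" by simp
  moreover have "k \<noteq> of_nat (Suc n)" using assms by blast
  ultimately show ?case by (simp add: less_le add.commute)
qed

text \<open>Either induction carries \<open>P\<close> up to the nonstandard \<open>N\<close>, or
  \<open>P\<close> holds at some \<open>k\<close> and fails at \<open>k + 1\<close>. Then
  \<open>k + 1\<close> is not standard, hence neither is \<open>k\<close>.\<close>

lemma overspill:
  fixes P :: "'a::peano_model \<Rightarrow> bool" and N :: 'a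
  assumes P: "dfn (\<lambda>e. P (e 0))" and std: "\<And>n::nat. P (of_nat n)" and N: "N \<notin> range of_nat"
  shows "\<exists>k. k \<notin> range of_nat \<and> P k"
proof (cases "\<forall>k. P k \<longrightarrow> P (k + 1)")
  case True
  then have "P N" using dfn_induct[OF P, of N] std[of 0] by simp
  then show ?thesis using N by blast
next
  case False
  then obtain k where k: "P k" "\<not> P (k + 1)" by blast
  have "k \<noteq> of_nat n" for n using k(2) std[of "Suc n"] by (auto simp: add.commute)
  then show ?thesis using k(1) by blast
qed

primrec num_tm :: "nat \<Rightarrow> tm" where
  "num_tm 0 = Zero"
| "num_tm (Suc n) = Add One (num_tm n)"

lemma tm_val_num_tm [simp]: "tm_val e (num_tm n) = (of_nat n :: 'a::peano_model)"
  by (induction n) simp_all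

lemma tm_vars_num_tm [simp]: "tm_vars (num_tm n) = {}"
  by (induction n) simp_all

text \<open>All witnesses are at most \<open>a\<close>, which makes the graph
  \<open>\<Delta>\<^sub>0\<close>. The number two is spelled \<open>1 + 1\<close> to match the terms
  of the language.\<close>

lemma seq_nth_bounded_iff:
  "seq_nth a i = x \<longleftrightarrow> (\<exists>u<a + 1. \<exists>v<a + 1. \<exists>q<a + 1. (1 + 1) * a = (u + v) * (u + v + 1) + (1 + 1) * v \<and>
     u = q * (1 + (i + 1) * v) + x \<and> x < 1 + (i + 1) * (v::'a::peano_model))" (is "_ = ?R")
proof
  assume "seq_nth a i = x"
  then obtain q where q: "cfst a = q * (1 + (i + 1) * csnd a) + x" "x < 1 + (i + 1) * csnd a"
    unfolding seq_nth_iff by blast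
  have "q \<le> cfst a" unfolding q(1) le_iff_add
    by (rule exI[of _ "q * ((i + 1) * csnd a) + x"]) (simp add: algebra_simps)
  moreover have "cfst a \<le> a" "csnd a \<le> a" by (rule cfst_le csnd_le)+
  moreover have "cpair a (cfst a) (csnd a)" by (simp add: cpair_iff_pr)
  ultimately show ?R using q unfolding cpair_def one_add_one
    by (intro exI[of _ "cfst a"] exI[of _ "csnd a"] conjI exI[of _ q]) auto
next
  assume ?R
  then obtain u v q where "cpair a u v" "u = q * (1 + (i + 1) * v) + x" "x < 1 + (i + 1) * v"
    unfolding cpair_def one_add_one by blast
  then show "seq_nth a i = x" unfolding cpair_iff_pr seq_nth_iff by auto
qed

lemma seq_nth_in_Def0: "seq_nth a (of_nat n) \<in> Def0 (a::'a::peano_model)"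
proof -
  \<comment> \<open>Variable \<open>0\<close> is the entry, \<open>1\<close> the code, and
    \<open>2\<close>, \<open>3\<close>, \<open>4\<close> are \<open>u\<close>, \<open>v\<close>,
    \<open>q\<close>. The index is standard, so a closed numeral denotes it.\<close>
  let ?b = "\<lambda>x \<phi>. Exists x (Conj (Less (Var x) (Add (Var 1) One)) \<phi>)"
  let ?w = "Add (Var 2) (Var 3)" and ?two = "Add One One"
  let ?m = "Add One (Mul (Add (num_tm n) One) (Var 3))"
  let ?\<phi> = "?b 2 (?b 3 (?b 4 (Conj (Eq (Mul ?two (Var 1)) (Add (Mul ?w (Add ?w One)) (Mul ?two (Var 3))))
    (Conj (Eq (Var 2) (Add (Mul (Var 4) ?m) (Var 0))) (Less (Var 0) ?m)))))"
  have "Delta0 ?\<phi>" by (intro Delta0.intros) simp_all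
  moreover have "free_vars ?\<phi> \<subseteq> {0, 1}" by auto
  moreover have "sat ((\<lambda>_. 0)(0 := x, 1 := a)) ?\<phi> \<longleftrightarrow> x = seq_nth a (of_nat n)" for x
    unfolding eq_commute[of x] seq_nth_bounded_iff by simp
  ultimately show ?thesis unfolding Def0_def by blast
qed

text \<open>A standard \<open>\<Delta>\<^sub>0\<close> formula or term becomes an index \<open>n = \<langle>t, \<langle>i, j\<rangle>\<rangle>\<close>, where \<open>t\<close> selects an
  operation on the functions with smaller indices \<open>i\<close> and \<open>j\<close>; formulas are functions with nonzero
  meaning true.  The argument \<open>s\<close> is a de Bruijn assignment \<open>\<langle>x\<^sub>0, \<langle>x\<^sub>1, \<dots>\<rangle>\<rangle>\<close>, so a bounded
  quantifier pushes its witness onto \<open>s\<close>.  The code \<open>W\<close> stores the value of function \<open>n\<close> at \<open>s\<close>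
  as \<open>((W)\<^sub>n)\<^sub>s\<close>.\<close>

definition eval_op :: "'a::peano_model \<Rightarrow> 'a \<Rightarrow> 'a \<Rightarrow> 'a \<Rightarrow> 'a \<Rightarrow> 'a \<Rightarrow> 'a" where
  "eval_op E W t i j s =
    (if t = 0 then s
     else if t = 1 then cfst (seq_nth (seq_nth W i) s)
     else if t = 2 then csnd (seq_nth (seq_nth W i) s)
     else if t = 3 then seq_nth (seq_nth W i) s + seq_nth (seq_nth W j) s
     else if t = 4 then seq_nth (seq_nth W i) s * seq_nth (seq_nth W j) s
     else if t = 5 then if seq_nth (seq_nth W i) s = seq_nth (seq_nth W j) s then 1 else 0
     else if t = 6 then if seq_nth (seq_nth W i) s < seq_nth (seq_nth W j) s then 1 else 0
     else if \<exists>x<seq_nth (seq_nth W i) s. pr x s \<le> E \<and> seq_nth (seq_nth W j) (pr x s) \<noteq> 0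
       then 1 else 0)"

definition eval_clause :: "'a::peano_model \<Rightarrow> 'a \<Rightarrow> 'a \<Rightarrow> 'a \<Rightarrow> 'a" where
  "eval_clause E W n s = eval_op E W (cfst n) (cfst (csnd n)) (csnd (csnd n)) s"

text \<open>Tag \<open>0\<close> does not consult \<open>W\<close>; with any other tag the operand
  indices are smaller than \<open>n\<close>.\<close>

lemma eval_clause_local:
  assumes "\<And>i. i < n \<Longrightarrow> seq_nth W i = seq_nth W' i"
  shows "eval_clause E W n s = eval_clause E W' n s"
proof (cases "cfst n = 0")
  case True
  then show ?thesis by (simp add: eval_clause_def eval_op_def)
next
  case False
  then have "csnd n < n" using pr_greater[of "cfst n" "csnd n"] by simp
  moreover have "cfst (csnd n) \<le> csnd n" "csnd (csnd n) \<le> csnd n"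
    by (rule cfst_le csnd_le)+
  ultimately have "seq_nth W (cfst (csnd n)) = seq_nth W' (cfst (csnd n))"
    "seq_nth W (csnd (csnd n)) = seq_nth W' (csnd (csnd n))"
    using assms by (meson le_less_trans)+
  then show ?thesis by (simp add: eval_clause_def eval_op_def)
qed

text \<open>Given the earlier rows, row \<open>n\<close> is a definable function of
  \<open>s\<close>, so \<open>beta_lemma\<close> codes it and \<open>dependent_choice\<close>
  assembles the rows.\<close>

lemma evaluator_ex:
  fixes E N :: "'a::peano_model"
  shows "\<exists>W. \<forall>n<N. \<forall>s\<le>E. seq_nth (seq_nth W n) s = eval_clause E W n s"
proof (rule dependent_choice[of "\<lambda>W n w. \<forall>s\<le>E. seq_nth w s = eval_clause E W n s"])
  show "dfn (\<lambda>e. \<forall>s\<le>E. seq_nth (e 2) s = eval_clause E (e 0) (e 1) s)"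
    unfolding eval_clause_def eval_op_def by (intro dfn_intros)
  show "\<exists>w. \<forall>s\<le>E. seq_nth w s = eval_clause E W n s" for W n
  proof -
    have "tdf (\<lambda>e. eval_clause E W n (e 0))"
      unfolding eval_clause_def eval_op_def by (intro dfn_intros)
    from beta_lemma[OF this, of "E + 1"] show ?thesis by simp
  qed
  show "\<forall>s\<le>E. seq_nth w s = eval_clause E W' n s"
    if "\<And>i. i < n \<Longrightarrow> seq_nth W i = seq_nth W' i" "\<forall>s\<le>E. seq_nth w s = eval_clause E W n s"
    for W W' n w
    using that(2) eval_clause_local[of n W W', OF that(1)] by simp
qed

text \<open>Keeps the indices of standard formulas standard: the pairing equation is transferred
  from \<open>nat\<close>.\<close>

lemma pr_of_nat: "\<exists>n. pr (of_nat u) (of_nat v) = (of_nat n :: 'a::peano_model)"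
proof -
  obtain n :: nat where "cpair n u v" using cpair_total by blast
  then have "of_nat (2 * n) = (of_nat ((u + v) * (u + v + 1) + 2 * v) :: 'a)"
    unfolding cpair_def by simp
  then have "cpair (of_nat n :: 'a) (of_nat u) (of_nat v)" unfolding cpair_def
    by (simp only: of_nat_add of_nat_mult of_nat_numeral of_nat_1)
  then show ?thesis unfolding cpair_iff_pr by metis
qed

definition stack_nth :: "'a::peano_model \<Rightarrow> nat \<Rightarrow> 'a" where
  "stack_nth s k = cfst ((csnd ^^ k) s)"

lemma stack_nth_pr [simp]: "stack_nth (pr x s) 0 = x" "stack_nth (pr x s) (Suc k) = stack_nth s k"
  by (simp_all add: stack_nth_def funpow_Suc_right del: funpow.simps(2))

lemma stack_nth_le: "stack_nth s k \<le> (s::'a::peano_model)"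
proof -
  have "(csnd ^^ k) s \<le> s" by (induction k) (auto intro: order_trans[OF csnd_le])
  then show ?thesis unfolding stack_nth_def using cfst_le order_trans by blast
qed

text \<open>The table \<open>W\<close> is correct for arguments up to \<open>E\<close>. The closure
  of \<open>K\<close> keeps term values and stacks with pushed witnesses inside \<open>K\<close>, so
  the guard \<open>pr x s \<le> E\<close> of the quantifier clause excludes nothing there.\<close>

locale delta0_eval =
  fixes E W :: "'a::peano_model" and K :: "'a set"
  assumes W: "\<And>n s. s \<le> E \<Longrightarrow> seq_nth (seq_nth W (of_nat n)) s = eval_clause E W (of_nat n) s"
    and K_le: "\<And>s. s \<in> K \<Longrightarrow> s \<le> E"
    and K_down: "\<And>s x. s \<in> K \<Longrightarrow> x \<le> s \<Longrightarrow> x \<in> K"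
    and K_one: "1 \<in> K"
    and K_add: "\<And>x y. x \<in> K \<Longrightarrow> y \<in> K \<Longrightarrow> x + y \<in> K"
    and K_mult: "\<And>x y. x \<in> K \<Longrightarrow> y \<in> K \<Longrightarrow> x * y \<in> K"
begin

abbreviation ev :: "nat \<Rightarrow> 'a \<Rightarrow> 'a" where "ev n s \<equiv> seq_nth (seq_nth W (of_nat n)) s"

lemma K_pr: "x \<in> K \<Longrightarrow> y \<in> K \<Longrightarrow> pr x y \<in> K"
  using pr_le by (meson K_down K_add K_mult K_one)

lemma op_ex: "\<exists>n. \<forall>s\<le>E. ev n s = eval_op E W (of_nat t) (of_nat i) (of_nat j) s"
proof -
  obtain m where m: "pr (of_nat i) (of_nat j) = (of_nat m::'a)" using pr_of_nat by blast
  obtain n where n: "pr (of_nat t) (of_nat m) = (of_nat n::'a)" using pr_of_nat by blast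
  have "ev n s = eval_op E W (of_nat t) (of_nat i) (of_nat j) s" if "s \<le> E" for s
    unfolding W[OF that] unfolding n[symmetric] m[symmetric] eval_clause_def by simp
  then show ?thesis by blast
qed

lemma id_ex: "\<exists>n. \<forall>s\<le>E. ev n s = s"
  using op_ex[of 0 0 0] by (simp add: eval_op_def)

lemma cfst_ex: "\<exists>n. \<forall>s\<le>E. ev n s = cfst (ev i s)"
  using op_ex[of 1 i 0] by (simp add: eval_op_def)

lemma csnd_ex: "\<exists>n. \<forall>s\<le>E. ev n s = csnd (ev i s)"
  using op_ex[of 2 i 0] by (simp add: eval_op_def)

lemma add_ex: "\<exists>n. \<forall>s\<le>E. ev n s = ev i s + ev j s"
  using op_ex[of 3 i j] by (simp add: eval_op_def)

lemma mult_ex: "\<exists>n. \<forall>s\<le>E. ev n s = ev i s * ev j s"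
  using op_ex[of 4 i j] by (simp add: eval_op_def)

lemma eq_ex: "\<exists>n. \<forall>s\<le>E. ev n s = (if ev i s = ev j s then 1 else 0)"
  using op_ex[of 5 i j] by (simp add: eval_op_def)

lemma less_ex: "\<exists>n. \<forall>s\<le>E. ev n s = (if ev i s < ev j s then 1 else 0)"
  using op_ex[of 6 i j] by (simp add: eval_op_def)

lemma bex_ex:
  "\<exists>n. \<forall>s\<le>E. ev n s = (if \<exists>x<ev i s. pr x s \<le> E \<and> ev j (pr x s) \<noteq> 0 then 1 else 0)"
  using op_ex[of 7 i j] by (simp add: eval_op_def)

lemma zero_ex: "\<exists>n. \<forall>s\<le>E. ev n s = 0"
  using less_ex[of 0 0] by simp

lemma one_ex: "\<exists>n. \<forall>s\<le>E. ev n s = 1"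
  using eq_ex[of 0 0] by simp

lemma stack_ex: "\<exists>n. \<forall>s\<le>E. ev n s = stack_nth s k"
proof -
  have "\<exists>n. \<forall>s\<le>E. ev n s = (csnd ^^ k) s"
  proof (induction k)
    case 0
    show ?case using id_ex by simp
  next
    case (Suc k)
    then obtain n where n: "\<And>s. s \<le> E \<Longrightarrow> ev n s = (csnd ^^ k) s" by blast
    show ?case using csnd_ex[of n] n by simp
  qed
  then obtain n where n: "\<And>s. s \<le> E \<Longrightarrow> ev n s = (csnd ^^ k) s" by blast
  show ?thesis unfolding stack_nth_def using cfst_ex[of n] n by simp
qed

text \<open>Holds for every \<open>s \<le> E\<close>, not only on \<open>K\<close>, since a row may
  store values beyond \<open>E\<close>.\<close>

lemma tm_ex: "\<exists>n. \<forall>s\<le>E. ev n s = tm_val (\<lambda>x. stack_nth s (\<rho> x)) t"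
proof (induction t)
  case (Var x)
  show ?case using stack_ex by simp
next
  case Zero
  show ?case using zero_ex by simp
next
  case One
  show ?case using one_ex by simp
next
  case (Add t1 t2)
  then obtain i j where "\<And>s. s \<le> E \<Longrightarrow> ev i s = tm_val (\<lambda>x. stack_nth s (\<rho> x)) t1"
    "\<And>s. s \<le> E \<Longrightarrow> ev j s = tm_val (\<lambda>x. stack_nth s (\<rho> x)) t2" by blast
  then show ?case using add_ex[of i j] by simp
next
  case (Mul t1 t2)
  then obtain i j where "\<And>s. s \<le> E \<Longrightarrow> ev i s = tm_val (\<lambda>x. stack_nth s (\<rho> x)) t1"
    "\<And>s. s \<le> E \<Longrightarrow> ev j s = tm_val (\<lambda>x. stack_nth s (\<rho> x)) t2" by blast
  then show ?case using mult_ex[of i j] by simp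
qed

lemma tm_val_in_K: "s \<in> K \<Longrightarrow> tm_val (\<lambda>x. stack_nth s (\<rho> x)) t \<in> K"
proof (induction t)
  case (Var x)
  then show ?case using K_down[OF _ stack_nth_le] by simp
next
  case Zero
  then show ?case using K_down[OF K_one, of 0] by simp
qed (simp_all add: K_one K_add K_mult)

text \<open>Negation is comparison with zero and conjunction is a product, as there are no zero
  divisors. For a bounded quantifier, the bound lies in \<open>K\<close> by
  \<open>tm_val_in_K\<close>, hence so does every stack with a pushed witness.\<close>

lemma Delta0_ex:
  "Delta0 \<phi> \<Longrightarrow> \<exists>n. \<forall>s\<in>K. ev n s \<noteq> 0 \<longleftrightarrow> sat (\<lambda>x. stack_nth s (\<rho> x)) \<phi>"
proof (induction arbitrary: \<rho> rule: Delta0.induct)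
  case (1 t1 t2)
  obtain i where "\<And>s. s \<le> E \<Longrightarrow> ev i s = tm_val (\<lambda>x. stack_nth s (\<rho> x)) t1" using tm_ex by blast
  moreover obtain j where "\<And>s. s \<le> E \<Longrightarrow> ev j s = tm_val (\<lambda>x. stack_nth s (\<rho> x)) t2" using tm_ex by blast
  moreover obtain n where "\<And>s. s \<le> E \<Longrightarrow> ev n s = (if ev i s = ev j s then 1 else 0)" using eq_ex by blast
  ultimately show ?case by (intro exI[of _ n]) (simp add: K_le)
next
  case (2 t1 t2)
  obtain i where "\<And>s. s \<le> E \<Longrightarrow> ev i s = tm_val (\<lambda>x. stack_nth s (\<rho> x)) t1" using tm_ex by blast
  moreover obtain j where "\<And>s. s \<le> E \<Longrightarrow> ev j s = tm_val (\<lambda>x. stack_nth s (\<rho> x)) t2" using tm_ex by blast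
  moreover obtain n where "\<And>s. s \<le> E \<Longrightarrow> ev n s = (if ev i s < ev j s then 1 else 0)" using less_ex by blast
  ultimately show ?case by (intro exI[of _ n]) (simp add: K_le)
next
  case (3 \<phi>)
  obtain i where "\<And>s. s \<in> K \<Longrightarrow> ev i s \<noteq> 0 \<longleftrightarrow> sat (\<lambda>x. stack_nth s (\<rho> x)) \<phi>"
    using "3.IH"[of \<rho>] by blast
  moreover obtain z where "\<And>s. s \<le> E \<Longrightarrow> ev z s = 0" using zero_ex by blast
  moreover obtain n where "\<And>s. s \<le> E \<Longrightarrow> ev n s = (if ev i s = ev z s then 1 else 0)" using eq_ex by blast
  ultimately show ?case by (intro exI[of _ n]) (auto simp: K_le)
next
  case (4 \<phi> \<psi>)
  obtain i where "\<And>s. s \<in> K \<Longrightarrow> ev i s \<noteq> 0 \<longleftrightarrow> sat (\<lambda>x. stack_nth s (\<rho> x)) \<phi>"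
    using "4.IH"(1)[of \<rho>] by blast
  moreover obtain j where "\<And>s. s \<in> K \<Longrightarrow> ev j s \<noteq> 0 \<longleftrightarrow> sat (\<lambda>x. stack_nth s (\<rho> x)) \<psi>"
    using "4.IH"(2)[of \<rho>] by blast
  moreover obtain n where "\<And>s. s \<le> E \<Longrightarrow> ev n s = ev i s * ev j s" using mult_ex by blast
  ultimately show ?case by (intro exI[of _ n]) (auto simp: K_le)
next
  case (5 \<phi> y t)
  \<comment> \<open>The pushed witness is at depth \<open>0\<close> and all other variables lie one
    deeper.\<close>
  let ?\<rho> = "\<lambda>x. if x = y then 0 else Suc (\<rho> x)"
  obtain i where i: "\<And>s. s \<le> E \<Longrightarrow> ev i s = tm_val (\<lambda>x. stack_nth s (\<rho> x)) t" using tm_ex by blast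
  obtain j where j: "\<And>s. s \<in> K \<Longrightarrow> ev j s \<noteq> 0 \<longleftrightarrow> sat (\<lambda>x. stack_nth s (?\<rho> x)) \<phi>"
    using "5.IH"[of ?\<rho>] by blast
  obtain n where n: "\<And>s. s \<le> E \<Longrightarrow>
      ev n s = (if \<exists>x<ev i s. pr x s \<le> E \<and> ev j (pr x s) \<noteq> 0 then 1 else 0)"
    using bex_ex by blast
  have "ev n s \<noteq> 0 \<longleftrightarrow> sat (\<lambda>x. stack_nth s (\<rho> x)) (Exists y (Conj (Less (Var y) t) \<phi>))"
    if s: "s \<in> K" for s
  proof -
    let ?e = "\<lambda>x. stack_nth s (\<rho> x)"
    have env: "(\<lambda>x. stack_nth (pr a s) (?\<rho> x)) = ?e(y := a)" for a by auto
    have t: "tm_val (?e(y := a)) t = tm_val ?e t" for a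
      using 5(2) by (intro tm_val_cong) auto
    have "pr a s \<le> E \<and> ev j (pr a s) \<noteq> 0 \<longleftrightarrow> sat (?e(y := a)) \<phi>" if "a < tm_val ?e t" for a
    proof -
      have "pr a s \<in> K"
        using K_pr[OF _ s] K_down[OF tm_val_in_K[OF s]] that less_imp_le by blast
      then show ?thesis using j[of "pr a s"] K_le[of "pr a s"] unfolding env by blast
    qed
    then have "(\<exists>a<tm_val ?e t. pr a s \<le> E \<and> ev j (pr a s) \<noteq> 0) \<longleftrightarrow>
        (\<exists>a<tm_val ?e t. sat (?e(y := a)) \<phi>)" by blast
    then show ?thesis
      unfolding n[OF K_le[OF s]] i[OF K_le[OF s]] by (simp add: t del: fun_upd_apply) simp
  qed
  then show ?case by blast
qed

end

text \<open>Entry \<open>N\<close> of the coded sequence of powers is a bound: the sequence is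
  nondecreasing because \<open>1 \<le> m\<close>, and its standard entries are the powers
  \<open>m ^ j\<close>.\<close>

lemma power_bound_ex:
  fixes m N :: "'a::peano_model"
  assumes N: "N \<notin> range of_nat" and m: "1 \<le> m"
  shows "\<exists>E. \<forall>j::nat. m ^ j \<le> E"
proof -
  obtain s where s: "seq_nth s 0 = 1" "\<And>i. i < N \<Longrightarrow> seq_nth s (i + 1) = m * seq_nth s i"
    using power_sequence[of N m] by blast
  have std: "seq_nth s (of_nat j) = m ^ j" for j
  proof (induction j)
    case (Suc j)
    then show ?case using s(2)[OF nonstandard_greater[OF N, of j]] by (simp add: add.commute)
  qed (use s(1) in simp)
  have "k \<le> N \<longrightarrow> (\<forall>i\<le>k. seq_nth s i \<le> seq_nth s k)" for k
  proof (rule dfn_induct[of "\<lambda>k. k \<le> N \<longrightarrow> (\<forall>i\<le>k. seq_nth s i \<le> seq_nth s k)"])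
    show "dfn (\<lambda>e. e 0 \<le> N \<longrightarrow> (\<forall>i\<le>e 0. seq_nth s i \<le> seq_nth s (e 0)))" by (intro dfn_intros)
    show "0 \<le> N \<longrightarrow> (\<forall>i\<le>0. seq_nth s i \<le> seq_nth s 0)" by simp
    fix k assume IH: "k \<le> N \<longrightarrow> (\<forall>i\<le>k. seq_nth s i \<le> seq_nth s k)"
    show "k + 1 \<le> N \<longrightarrow> (\<forall>i\<le>k + 1. seq_nth s i \<le> seq_nth s (k + 1))"
    proof (intro impI allI)
      fix i assume "k + 1 \<le> N" and i: "i \<le> k + 1"
      then have k: "k < N" by simp
      show "seq_nth s i \<le> seq_nth s (k + 1)"
      proof (cases "i = k + 1")
        case False
        then have "i \<le> k" using i PA_less_add_one[of i k] by (simp add: less_le)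
        then have "seq_nth s i \<le> seq_nth s k" using IH less_imp_le[OF k] by blast
        also have "\<dots> \<le> m * seq_nth s k" using mult_right_mono[OF m, of "seq_nth s k"] by simp
        finally show ?thesis using s(2)[OF k] by simp
      qed simp
    qed
  qed
  then have "m ^ j \<le> seq_nth s N" for j
    using std[of j] less_imp_le[OF nonstandard_greater[OF N, of j]] by (metis order_refl)
  then show ?thesis by blast
qed

text \<open>Entry \<open>n\<close> of \<open>g\<close> is some \<open>y \<le> d\<close> accepted by
  table row \<open>n\<close>, if there is one. A defining formula has a standard row, which accepts
  only the element it defines.\<close>

lemma Def0_enumerated:
  fixes a d N :: "'a::peano_model"
  assumes N: "N \<notin> range of_nat"
  shows "\<exists>g. \<forall>y\<in>Def0 a. y \<le> d \<longrightarrow> (\<exists>n::nat. seq_nth g (of_nat n) = y)"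
proof -
  \<comment> \<open>The arguments \<open>a\<close> and \<open>y \<le> d\<close> are at most
    \<open>?m\<close>. The summand \<open>2\<close> lets one factor \<open>?m\<close> absorb a
    doubling, which closes \<open>?K\<close> under addition.\<close>
  let ?m = "a + d + 2"
  have m1: "1 \<le> ?m" unfolding le_iff_add by (rule exI[of _ "a + d + 1"]) (simp add: algebra_simps flip: one_add_one)
  obtain E where E: "\<And>j::nat. ?m ^ j \<le> E" using power_bound_ex[OF N m1] by blast
  obtain W where W: "\<And>n s. n < N \<Longrightarrow> s \<le> E \<Longrightarrow> seq_nth (seq_nth W n) s = eval_clause E W n s"
    using evaluator_ex[of N E] by blast
  let ?K = "{s. \<exists>j::nat. s \<le> ?m ^ j}"
  interpret delta0_eval E W ?K
  proof
    fix s x y :: 'a and n :: nat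
    show "s \<le> E \<Longrightarrow> seq_nth (seq_nth W (of_nat n)) s = eval_clause E W (of_nat n) s"
      by (rule W[OF nonstandard_greater[OF N]])
    show "s \<in> ?K \<Longrightarrow> s \<le> E" using E order_trans by blast
    show "s \<in> ?K \<Longrightarrow> x \<le> s \<Longrightarrow> x \<in> ?K" using order_trans by blast
    show "1 \<in> ?K" by (auto intro: exI[of _ 0])
    show mult: "x \<in> ?K \<Longrightarrow> y \<in> ?K \<Longrightarrow> x * y \<in> ?K" for x y
    proof -
      assume "x \<in> ?K" "y \<in> ?K"
      then obtain j k where "x \<le> ?m ^ j" "y \<le> ?m ^ k" by blast
      then have "x * y \<le> ?m ^ (j + k)" unfolding power_add by (intro mult_mono) auto
      then show ?thesis by blast
    qed
    show "x \<in> ?K \<Longrightarrow> y \<in> ?K \<Longrightarrow> x + y \<in> ?K"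
    proof -
      assume "x \<in> ?K" "y \<in> ?K"
      then have "max x y \<in> ?K" by (simp add: max_def)
      moreover have "?m \<in> ?K" by (auto intro: exI[of _ 1])
      ultimately have *: "?m * max x y \<in> ?K" by (rule mult[rotated])
      have "x + y \<le> max x y + max x y" by (intro add_mono) auto
      also have "\<dots> \<le> (a + d) * max x y + (max x y + max x y)"
        using add_right_mono[of 0 "(a + d) * max x y"] by simp
      also have "\<dots> = ?m * max x y" by (simp add: distrib_right mult_2)
      finally show ?thesis using * order_trans by blast
    qed
  qed
  \<comment> \<open>The stack holds \<open>y\<close> at depth \<open>0\<close> and \<open>a\<close>
    at depth \<open>1\<close>, as the variables in \<open>Def0\<close> require.\<close>
  let ?T = "\<lambda>n y. seq_nth (seq_nth W n) (pr y (pr a 0)) \<noteq> 0"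
  let ?R = "\<lambda>g n y. (\<exists>z. z \<le> d \<and> ?T n z) \<longrightarrow> y \<le> d \<and> ?T n y"
  have "\<exists>g. \<forall>n<N. ?R g n (seq_nth g n)"
  proof (rule dependent_choice[of ?R])
    show "dfn (\<lambda>e. ?R (e 0) (e 1) (e 2))" by (intro dfn_intros)
    show "\<exists>y. ?R g n y" for g n by blast
  qed
  then obtain g where g: "\<And>n. n < N \<Longrightarrow> ?R g n (seq_nth g n)" by blast
  have "\<exists>n::nat. seq_nth g (of_nat n) = y" if y: "y \<in> Def0 a" "y \<le> d" for y
  proof -
    obtain \<phi> where \<phi>: "Delta0 \<phi>" "free_vars \<phi> \<subseteq> {0, 1}"
      "\<And>x. sat ((\<lambda>_. 0)(0 := x, 1 := a)) \<phi> \<longleftrightarrow> x = y"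
      using y(1) unfolding Def0_def by blast
    obtain n where n: "\<And>s. s \<in> ?K \<Longrightarrow> ev n s \<noteq> 0 \<longleftrightarrow> sat (\<lambda>x. stack_nth s (id x)) \<phi>"
      using Delta0_ex[OF \<phi>(1), of id] by blast
    have T: "?T (of_nat n) x \<longleftrightarrow> x = y" if "x \<le> d" for x
    proof -
      have "?m \<in> ?K" by (auto intro: exI[of _ 1])
      moreover have "x \<le> ?m" using add_mono[OF add_mono[OF zero_le[of a] that] zero_le[of 2]] by simp
      moreover have "a \<le> ?m" using add_left_mono[OF zero_le[of "d + 2"], of a] by (simp add: add.assoc)
      ultimately have "pr x (pr a 0) \<in> ?K"
        by (intro K_pr K_down[of ?m x] K_down[of ?m a] K_down[of ?m 0]) auto
      moreover have "sat (\<lambda>k. stack_nth (pr x (pr a 0)) (id k)) \<phi> =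
          sat ((\<lambda>_. 0)(0 := x, 1 := a)) \<phi>"
        using \<phi>(2) by (intro sat_cong) auto
      ultimately show ?thesis using n \<phi>(3) by blast
    qed
    have "?R g (of_nat n) (seq_nth g (of_nat n))" by (rule g[OF nonstandard_greater[OF N]])
    then show ?thesis using T y(2) by blast
  qed
  then show ?thesis by blast
qed

section \<open>Cuts\<close>

lemma cut_zero: "is_cut I \<Longrightarrow> 0 \<in> I"
  unfolding is_cut_def by auto

lemma cut_down: "is_cut I \<Longrightarrow> x \<in> I \<Longrightarrow> y \<le> x \<Longrightarrow> y \<in> I"
  unfolding is_cut_def by blast

lemma cut_Suc: "is_cut I \<Longrightarrow> x \<in> I \<Longrightarrow> x + 1 \<in> I"
  unfolding is_cut_def by blast

lemma cut_less: "is_cut I \<Longrightarrow> x \<in> I \<Longrightarrow> y \<notin> I \<Longrightarrow> x < y"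
  using cut_down[of I x y] by (auto simp: not_le[symmetric])

lemma notin_cut_nonstandard:
  assumes I: "is_cut I" and d: "d \<notin> I" shows "d \<notin> range of_nat"
proof -
  have "of_nat n \<in> I" for n
    by (induction n) (auto simp: cut_zero[OF I] add.commute[of 1] cut_Suc[OF I])
  then show ?thesis using d by blast
qed

lemma obtain_notin_cut:
  assumes "is_cut I" obtains d where "d \<notin> I"
proof -
  have "I \<noteq> UNIV" using assms unfolding is_cut_def by simp
  then show ?thesis using that by blast
qed

lemma seq_max_ex: "\<exists>i\<le>k. \<forall>j\<le>k. seq_nth a j \<le> seq_nth (a::'a::peano_model) i"
proof (rule dfn_induct[of "\<lambda>k. \<exists>i\<le>k. \<forall>j\<le>k. seq_nth a j \<le> seq_nth a i"])
  show "dfn (\<lambda>e. \<exists>i\<le>e 0. \<forall>j\<le>e 0. seq_nth a j \<le> seq_nth a i)" by (intro dfn_intros)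
  show "\<exists>i\<le>0. \<forall>j\<le>0. seq_nth a j \<le> seq_nth a i" by simp
  fix k assume "\<exists>i\<le>k. \<forall>j\<le>k. seq_nth a j \<le> seq_nth a i"
  then obtain i where i: "i \<le> k" "\<And>j. j \<le> k \<Longrightarrow> seq_nth a j \<le> seq_nth a i" by blast
  have s: "j \<le> k + 1 \<longleftrightarrow> j \<le> k \<or> j = k + 1" for j
    using PA_less_add_one[of j k] by (simp only: le_less[of j "k + 1"])
  show "\<exists>i\<le>k + 1. \<forall>j\<le>k + 1. seq_nth a j \<le> seq_nth a i"
  proof (cases "seq_nth a i \<le> seq_nth a (k + 1)")
    case True
    then show ?thesis using i(2) order_trans unfolding s by blast
  next
    case False
    then show ?thesis using i unfolding s by (intro exI[of _ i]) auto
  qed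
qed

lemma seq_min_ex: "\<exists>i\<le>k. \<forall>j\<le>k. seq_nth a i \<le> seq_nth (a::'a::peano_model) j"
proof (rule dfn_induct[of "\<lambda>k. \<exists>i\<le>k. \<forall>j\<le>k. seq_nth a i \<le> seq_nth a j"])
  show "dfn (\<lambda>e. \<exists>i\<le>e 0. \<forall>j\<le>e 0. seq_nth a i \<le> seq_nth a j)" by (intro dfn_intros)
  show "\<exists>i\<le>0. \<forall>j\<le>0. seq_nth a i \<le> seq_nth a j" by simp
  fix k assume "\<exists>i\<le>k. \<forall>j\<le>k. seq_nth a i \<le> seq_nth a j"
  then obtain i where i: "i \<le> k" "\<And>j. j \<le> k \<Longrightarrow> seq_nth a i \<le> seq_nth a j" by blast
  have s: "j \<le> k + 1 \<longleftrightarrow> j \<le> k \<or> j = k + 1" for j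
    using PA_less_add_one[of j k] by (simp only: le_less[of j "k + 1"])
  show "\<exists>i\<le>k + 1. \<forall>j\<le>k + 1. seq_nth a i \<le> seq_nth a j"
  proof (cases "seq_nth a (k + 1) \<le> seq_nth a i")
    case True
    then show ?thesis using i(2) order_trans unfolding s by blast
  next
    case False
    then show ?thesis using i unfolding s by (intro exI[of _ i]) auto
  qed
qed

section \<open>From separable coded cuts to failure of coinitiality and cofinality\<close>

lemma coded_below_not_coinitial:
  fixes I :: "'a::peano_model set"
  assumes I: "is_cut I" and sep: "separable I"
    and a: "I = sup_seg (range (\<lambda>n::nat. seq_nth a (of_nat n)))"
  shows "\<not> coinitial_in (Def0 b - I) (- I)"
proof
  assume co: "coinitial_in (Def0 b - I) (- I)"
  obtain d where d: "d \<notin> I" using obtain_notin_cut[OF I] .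
  note ns = notin_cut_nonstandard[OF I d]
  obtain g where g: "\<And>y. y \<in> Def0 b \<Longrightarrow> y \<le> d \<Longrightarrow> \<exists>n::nat. seq_nth g (of_nat n) = y"
    using Def0_enumerated[OF ns, of b d] by blast
  obtain c :: 'a where c: "\<And>n::nat. seq_nth g (of_nat n) \<in> I \<longleftrightarrow> mem (of_nat n) c"
    using sep unfolding separable_def by blast
  have aI: "seq_nth a (of_nat n) \<in> I" for n :: nat
    by (subst a) (auto simp: sup_seg_def)
  let ?P = "\<lambda>k. \<forall>i j. i \<le> k \<longrightarrow> j \<le> k \<longrightarrow> \<not> mem j c \<longrightarrow> seq_nth a i < seq_nth g j"
  have std: "?P (of_nat n)" for n :: nat
  proof (intro allI impI)
    fix i j :: 'a assume "i \<le> of_nat n" "j \<le> of_nat n" "\<not> mem j c"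
    then obtain i' j' :: nat where "i = of_nat i'" "j = of_nat j'"
      using nonstandard_greater[of i n] nonstandard_greater[of j n] by (auto simp: not_le[symmetric])
    then show "seq_nth a i < seq_nth g j" using cut_less[OF I aI, of _ i'] c[of j'] \<open>\<not> mem j c\<close> by auto
  qed
  have "dfn (\<lambda>e. ?P (e 0))" by (intro dfn_intros)
  then obtain k where k: "k \<notin> range of_nat" "?P k" using overspill[of ?P, OF _ std ns] by blast
  obtain i where i: "i \<le> k" "\<And>j. j \<le> k \<Longrightarrow> seq_nth a j \<le> seq_nth a i" using seq_max_ex by blast
  have le: "of_nat n \<le> k" for n :: nat using nonstandard_greater[OF k(1), of n] by simp
  \<comment> \<open>As \<open>k\<close> is nonstandard, the maximum dominates all standard entries,
    which are cofinal in \<open>I\<close>. Were it in \<open>I\<close>, its successor would be too,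
    and some standard entry would exceed it.\<close>
  have "seq_nth a i \<notin> I"
  proof
    assume "seq_nth a i \<in> I"
    then have "seq_nth a i + 1 \<in> I" by (rule cut_Suc[OF I])
    then obtain n :: nat where "seq_nth a i + 1 \<le> seq_nth a (of_nat n)"
      unfolding a sup_seg_def by blast
    then show False using i(2)[OF le[of n]] by simp
  qed
  \<comment> \<open>The minimum with \<open>d\<close> is taken because \<open>g\<close> is only
    known to list definable elements up to \<open>d\<close>.\<close>
  then have "min d (seq_nth a i) \<in> - I" using d by (simp add: min_def)
  then obtain y where y: "y \<in> Def0 b" "y \<notin> I" "y \<le> min d (seq_nth a i)"
    using co unfolding coinitial_in_def by blast
  then obtain n :: nat where n: "seq_nth g (of_nat n) = y" using g[of y] by auto
  have "\<not> mem (of_nat n) c" using c[of n] y(2) n by simp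
  then have "seq_nth a i < y" using k(2) i(1) le[of n] n by blast
  then show False using y(3) by (auto simp: not_less[symmetric] min_less_iff_disj)
qed

lemma coded_above_not_cofinal:
  fixes I :: "'a::peano_model set"
  assumes I: "is_cut I" and sep: "separable I"
    and a: "I = inf_seg (range (\<lambda>n::nat. seq_nth a (of_nat n)))"
  shows "\<not> cofinal_in (Def0 b \<inter> I) I"
proof
  assume co: "cofinal_in (Def0 b \<inter> I) I"
  obtain d where d: "d \<notin> I" using obtain_notin_cut[OF I] .
  note ns = notin_cut_nonstandard[OF I d]
  obtain g where g: "\<And>y. y \<in> Def0 b \<Longrightarrow> y \<le> d \<Longrightarrow> \<exists>n::nat. seq_nth g (of_nat n) = y"
    using Def0_enumerated[OF ns, of b d] by blast
  obtain c :: 'a where c: "\<And>n::nat. seq_nth g (of_nat n) \<in> I \<longleftrightarrow> mem (of_nat n) c"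
    using sep unfolding separable_def by blast
  have aI: "seq_nth a (of_nat n) \<notin> I" for n :: nat
    by (subst a) (auto simp: inf_seg_def)
  let ?P = "\<lambda>k. \<forall>i j. i \<le> k \<longrightarrow> j \<le> k \<longrightarrow> mem j c \<longrightarrow> seq_nth g j < seq_nth a i"
  have std: "?P (of_nat n)" for n :: nat
  proof (intro allI impI)
    fix i j :: 'a assume "i \<le> of_nat n" "j \<le> of_nat n" "mem j c"
    then obtain i' j' :: nat where "i = of_nat i'" "j = of_nat j'"
      using nonstandard_greater[of i n] nonstandard_greater[of j n] by (auto simp: not_le[symmetric])
    then show "seq_nth g j < seq_nth a i" using cut_less[OF I _ aI, of _ i'] c[of j'] \<open>mem j c\<close> by auto
  qed
  have "dfn (\<lambda>e. ?P (e 0))" by (intro dfn_intros)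
  then obtain k where k: "k \<notin> range of_nat" "?P k" using overspill[of ?P, OF _ std ns] by blast
  obtain i where i: "i \<le> k" "\<And>j. j \<le> k \<Longrightarrow> seq_nth a i \<le> seq_nth a j" using seq_min_ex by blast
  have le: "of_nat n \<le> k" for n :: nat using nonstandard_greater[OF k(1), of n] by simp
  \<comment> \<open>The minimum is at most every standard entry. As \<open>inf_seg\<close> is
    strict, the predecessor \<open>z\<close> is used: if it is outside \<open>I\<close>, some
    standard entry is at most \<open>z\<close>.\<close>
  have "seq_nth a i \<in> I"
  proof (rule ccontr)
    assume ni: "seq_nth a i \<notin> I"
    then have "seq_nth a i \<noteq> 0" using cut_zero[OF I] by metis
    then obtain z where z: "seq_nth a i = z + 1" by (rule PA_obtain_pred)
    then have "z \<notin> I" using ni cut_Suc[OF I, of z] by auto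
    then obtain n :: nat where "seq_nth a (of_nat n) \<le> z"
      unfolding a inf_seg_def by (auto simp: not_less)
    also have "z < seq_nth a i" unfolding z by simp
    finally show False using i(2)[OF le[of n]] by simp
  qed
  then obtain y where y: "y \<in> Def0 b" "y \<in> I" "seq_nth a i \<le> y"
    using co unfolding cofinal_in_def by blast
  then obtain n :: nat where n: "seq_nth g (of_nat n) = y"
    using g[of y] less_imp_le[OF cut_less[OF I y(2) d]] by blast
  have "mem (of_nat n) c" using c[of n] y(2) n by simp
  then have "y < seq_nth a i" using k(2) i(1) le[of n] n by blast
  then show False using y(3) by (auto simp: not_less[symmetric] min_less_iff_disj)
qed

section \<open>From superrational to separable and coded cuts\<close>

lemma separableI:
  fixes I :: "'a::peano_model set"
  assumes N: "N \<notin> range (of_nat :: nat \<Rightarrow> 'a)"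
    and "\<And>u. \<exists>x. \<forall>n::nat. seq_nth u (of_nat n) \<in> I \<longleftrightarrow> seq_nth u (of_nat n) < x"
  shows "separable I"
  unfolding separable_def
proof
  fix u
  obtain x where x: "\<And>n::nat. seq_nth u (of_nat n) \<in> I \<longleftrightarrow> seq_nth u (of_nat n) < x"
    using assms(2) by blast
  have "dfn (\<lambda>e. seq_nth u (e 0) < x)" by (intro dfn_intros)
  \<comment> \<open>The threshold \<open>x\<close> replaces the external condition of lying in
    \<open>I\<close> by a definable one, and \<open>N\<close> exceeds every standard index.\<close>
  from mem_comprehension[of "\<lambda>i. seq_nth u i < x", OF this, of N]
  obtain c :: 'a where "\<And>i. i < N \<Longrightarrow> mem i c \<longleftrightarrow> seq_nth u i < x" by blast
  then have "mem (of_nat n) c \<longleftrightarrow> seq_nth u (of_nat n) \<in> I" for n :: nat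
    using nonstandard_greater[OF N, of n] x[of n] by simp
  then show "\<exists>c::'a. \<forall>n::nat. seq_nth u (of_nat n) \<in> I \<longleftrightarrow> mem (of_nat n) c" by blast
qed

text \<open>Entries on the wrong side of the cut are overwritten by a harmless \<open>z\<close>:
  \<open>0\<close> for a code from below, some \<open>d\<close> outside the cut for a code from
  above.\<close>

lemma filtered_sequence:
  fixes N g c z :: "'a::peano_model"
  assumes N: "N \<notin> range of_nat"
  shows "\<exists>s. \<forall>n::nat. seq_nth s (of_nat n) = (if mem (of_nat n) c then seq_nth g (of_nat n) else z)"
    and "\<exists>s. \<forall>n::nat. seq_nth s (of_nat n) = (if mem (of_nat n) c then z else seq_nth g (of_nat n))"
proof -
  have "tdf (\<lambda>e. if mem (e 0) c then seq_nth g (e 0) else z)"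
    "tdf (\<lambda>e. if mem (e 0) c then z else seq_nth g (e 0))" by (intro dfn_intros)+
  from beta_lemma[of "\<lambda>i. if mem i c then seq_nth g i else z", OF this(1), of N]
    beta_lemma[of "\<lambda>i. if mem i c then z else seq_nth g i", OF this(2), of N]
  show "\<exists>s. \<forall>n::nat. seq_nth s (of_nat n) = (if mem (of_nat n) c then seq_nth g (of_nat n) else z)"
    "\<exists>s. \<forall>n::nat. seq_nth s (of_nat n) = (if mem (of_nat n) c then z else seq_nth g (of_nat n))"
    using nonstandard_greater[OF N] by blast+
qed

lemma Def0_cofinal_imp_coded:
  fixes I :: "'a::peano_model set"
  assumes I: "is_cut I" and cof: "cofinal_in (Def0 a \<inter> I) I"
    and nco: "\<And>b. \<not> coinitial_in (Def0 b - I) (- I)"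
  shows "coded_from_below I \<and> separable I"
proof
  obtain d where d: "d \<notin> I" using obtain_notin_cut[OF I] .
  note ns = notin_cut_nonstandard[OF I d]
  show sep: "separable I"
  proof (rule separableI[OF ns])
    fix u
    \<comment> \<open>Failure of coinitiality at \<open>u\<close> gives a threshold outside
      \<open>I\<close> but below all elements of \<open>Def0 u\<close> outside \<open>I\<close>, in
      particular below such entries of \<open>u\<close>.\<close>
    obtain x where x: "x \<notin> I" "\<And>y. y \<in> Def0 u \<Longrightarrow> y \<notin> I \<Longrightarrow> x < y"
      using nco[of u] unfolding coinitial_in_def by (auto simp: not_le)
    have "seq_nth u (of_nat n) \<in> I \<longleftrightarrow> seq_nth u (of_nat n) < x" for n :: nat
      using x(2)[OF seq_nth_in_Def0[of u n]] cut_less[OF I _ x(1)] by force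
    then show "\<exists>x. \<forall>n::nat. seq_nth u (of_nat n) \<in> I \<longleftrightarrow> seq_nth u (of_nat n) < x" by blast
  qed
  obtain g where g: "\<And>y. y \<in> Def0 a \<Longrightarrow> y \<le> d \<Longrightarrow> \<exists>n::nat. seq_nth g (of_nat n) = y"
    using Def0_enumerated[OF ns, of a d] by blast
  obtain c :: 'a where c: "\<And>n::nat. seq_nth g (of_nat n) \<in> I \<longleftrightarrow> mem (of_nat n) c"
    using sep unfolding separable_def by blast
  obtain s where s: "\<And>n::nat. seq_nth s (of_nat n) = (if mem (of_nat n) c then seq_nth g (of_nat n) else 0)"
    using filtered_sequence(1)[OF ns, of c g 0] by blast
  have "I = sup_seg (range (\<lambda>n::nat. seq_nth s (of_nat n)))"
  proof (intro equalityI subsetI)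
    fix x assume "x \<in> I"
    then obtain y where y: "y \<in> Def0 a" "y \<in> I" "x \<le> y" using cof unfolding cofinal_in_def by blast
    then obtain n :: nat where n: "seq_nth g (of_nat n) = y" using g[of y] less_imp_le[OF cut_less[OF I y(2) d]] by blast
    then have "seq_nth s (of_nat n) = y" using s[of n] c[of n] y(2) by simp
    then show "x \<in> sup_seg (range (\<lambda>n::nat. seq_nth s (of_nat n)))"
      using y(3) unfolding sup_seg_def by blast
  next
    fix x assume "x \<in> sup_seg (range (\<lambda>n::nat. seq_nth s (of_nat n)))"
    then obtain n :: nat where n: "x \<le> seq_nth s (of_nat n)" unfolding sup_seg_def by blast
    have "seq_nth s (of_nat n) \<in> I" using s[of n] c[of n] cut_zero[OF I] by simp
    then show "x \<in> I" using cut_down[OF I _ n] by blast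
  qed
  then show "coded_from_below I" unfolding coded_from_below_def by blast
qed

lemma Def0_coinitial_imp_coded:
  fixes I :: "'a::peano_model set"
  assumes I: "is_cut I" and coi: "coinitial_in (Def0 a - I) (- I)"
    and nco: "\<And>b. \<not> cofinal_in (Def0 b \<inter> I) I"
  shows "coded_from_above I \<and> separable I"
proof
  obtain d where d: "d \<notin> I" using obtain_notin_cut[OF I] .
  note ns = notin_cut_nonstandard[OF I d]
  show sep: "separable I"
  proof (rule separableI[OF ns])
    fix u
    \<comment> \<open>Here the threshold lies inside \<open>I\<close>, above all elements of
      \<open>Def0 u\<close> in \<open>I\<close>.\<close>
    obtain x where x: "x \<in> I" "\<And>y. y \<in> Def0 u \<Longrightarrow> y \<in> I \<Longrightarrow> y < x"
      using nco[of u] unfolding cofinal_in_def by (auto simp: not_le)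
    have "seq_nth u (of_nat n) \<in> I \<longleftrightarrow> seq_nth u (of_nat n) < x" for n :: nat
      using x(2)[OF seq_nth_in_Def0[of u n]] cut_less[OF I x(1)] by force
    then show "\<exists>x. \<forall>n::nat. seq_nth u (of_nat n) \<in> I \<longleftrightarrow> seq_nth u (of_nat n) < x" by blast
  qed
  obtain g where g: "\<And>y. y \<in> Def0 a \<Longrightarrow> y \<le> d \<Longrightarrow> \<exists>n::nat. seq_nth g (of_nat n) = y"
    using Def0_enumerated[OF ns, of a d] by blast
  obtain c :: 'a where c: "\<And>n::nat. seq_nth g (of_nat n) \<in> I \<longleftrightarrow> mem (of_nat n) c"
    using sep unfolding separable_def by blast
  obtain s where s: "\<And>n::nat. seq_nth s (of_nat n) = (if mem (of_nat n) c then d else seq_nth g (of_nat n))"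
    using filtered_sequence(2)[OF ns, of c d g] by blast
  have "I = inf_seg (range (\<lambda>n::nat. seq_nth s (of_nat n)))"
  proof (intro equalityI subsetI)
    fix x assume x: "x \<in> I"
    have "seq_nth s (of_nat n) \<notin> I" for n :: nat using s[of n] c[of n] d by simp
    then show "x \<in> inf_seg (range (\<lambda>n::nat. seq_nth s (of_nat n)))"
      using cut_less[OF I x] unfolding inf_seg_def by blast
  next
    fix x assume x: "x \<in> inf_seg (range (\<lambda>n::nat. seq_nth s (of_nat n)))"
    show "x \<in> I"
    proof (rule ccontr)
      assume "x \<notin> I"
      \<comment> \<open>Going below \<open>d\<close> as well ensures that the definable element
        found is listed by \<open>g\<close>.\<close>
      then have "min x d \<in> - I" using d by (simp add: min_def)
      then obtain y where y: "y \<in> Def0 a" "y \<notin> I" "y \<le> min x d"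
        using coi unfolding coinitial_in_def by blast
      then obtain n :: nat where n: "seq_nth g (of_nat n) = y" using g[of y] by auto
      then have "seq_nth s (of_nat n) = y" using s[of n] c[of n] y(2) by simp
      then have "x < y" using x unfolding inf_seg_def by blast
      then show False using y(3) by (auto simp: not_less[symmetric] min_less_iff_disj)
    qed
  qed
  then show "coded_from_above I" unfolding coded_from_above_def by blast
qed

text \<open>The entries of the code are themselves the required definable elements, by
  \<open>seq_nth_in_Def0\<close>.\<close>

lemma coded_from_below_imp_cofinal:
  assumes "I = sup_seg (range (\<lambda>n::nat. seq_nth a (of_nat n)))"
  shows "cofinal_in (Def0 a \<inter> I) I"
proof -
  have "seq_nth a (of_nat n) \<in> I" for n :: nat
    by (subst assms) (auto simp: sup_seg_def)
  moreover have "\<exists>n::nat. x \<le> seq_nth a (of_nat n)" if "x \<in> I" for x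
    using that unfolding assms sup_seg_def by blast
  ultimately show ?thesis unfolding cofinal_in_def using seq_nth_in_Def0 by blast
qed

lemma coded_from_above_imp_coinitial:
  assumes "I = inf_seg (range (\<lambda>n::nat. seq_nth a (of_nat n)))"
  shows "coinitial_in (Def0 a - I) (- I)"
proof -
  have "seq_nth a (of_nat n) \<notin> I" for n :: nat
    by (subst assms) (auto simp: inf_seg_def)
  moreover have "\<exists>n::nat. seq_nth a (of_nat n) \<le> x" if "x \<notin> I" for x
    using that unfolding assms inf_seg_def by (auto simp: not_less)
  ultimately show ?thesis unfolding coinitial_in_def using seq_nth_in_Def0 by blast
qed

theorem theorem3p4:
  fixes I :: "'a::peano_model set"
  assumes "is_cut I"
  shows "omega_coded I \<and> separable I \<longleftrightarrow> superrational0 I"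
proof
  assume "omega_coded I \<and> separable I"
  then have sep: "separable I" and "coded_from_below I \<or> coded_from_above I"
    unfolding omega_coded_def by auto
  then consider a where "I = sup_seg (range (\<lambda>n::nat. seq_nth a (of_nat n)))"
    | a where "I = inf_seg (range (\<lambda>n::nat. seq_nth a (of_nat n)))"
    unfolding coded_from_below_def coded_from_above_def by blast
  then show "superrational0 I"
  proof cases
    case 1
    then show ?thesis unfolding superrational0_def
      using coded_from_below_imp_cofinal coded_below_not_coinitial[OF assms sep] by blast
  next
    case 2
    then show ?thesis unfolding superrational0_def
      using coded_from_above_imp_coinitial coded_above_not_cofinal[OF assms sep] by blast
  qed
next
  assume "superrational0 I"
  then show "omega_coded I \<and> separable I"
    unfolding superrational0_def omega_coded_def
    using Def0_cofinal_imp_coded[OF assms] Def0_coinitial_imp_coded[OF assms] by blast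
qed

end
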